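(* Let $H(X,Y,q)$ be the mirror curve polynomial described in the context. There is $\epsilon>0$ such that for every $q\in(\mathbb{R}^* )^p$ with $|q_k|<\epsilon$ for all $k$, $a_i(q)<0$ whenever $m_i,n_i$ are both odd, and $a_i(q)>0$ whenever $m_i$ or $n_i$ is even, the following holds: if $l_i$ is the axis of $\mathbb{R}X_P$ corresponding to a side $r_i$ of $P$ of integer length $d_i$, then the unbounded component $W$ of the closure of the real mirror curve intersects $l_i$ in $d_i$ points.
   Context: Let $P\subset\mathbb{R}^2$ be a convex lattice polygon with a unimodular triangulation $T_\Sigma$ (triangles with lattice vertices and area $1/2$; vertex set $P\cap\mathbb{Z}^2$), encoding a smooth toric Calabi–Yau 3-fold. Write $P\cap\mathbb{Z}^2=\{b_1,\dots,b_{p+3}\}$, $b_i=(m_i,n_i)$, with $b_1=(1,0)$, $b_2=(0,1)$, $b_3=(0,0)$ and $\sigma_1=\{b_1,b_2,b_3\}$ a triangle of $T_\Sigma$. Let $L=\ker(\mathbb{Z}^{p+3}\to\mathbb{Z}^3,\ e_i\mapsto(m_i,n_i,1))$, $D_i\in L^\vee$ the restriction of the $i$-th coordinate functional; for a triangle $\sigma$ with vertex index set $I'_\sigma$, $\{D_j:j\notin I'_\sigma\}$ is a basis of $L^\vee\otimes\mathbb{Q}$. Fix $H_1,\dots,H_p\in L^\vee\otimes\mathbb{Q}$ with $H_k=\sum_{j\notin I'_\sigma}s^\sigma_{k,j}D_j$, $s^\sigma_{k,j}\in\mathbb{Z}_{\ge0}$, $(s^\sigma_{k,j})$ nondegenerate,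 for every triangle $\sigma$. Set $a_i(q)=1$ ($i=1,2,3$), $a_i(q)=\prod_k q_k^{s^{\sigma_1}_{k,i}}$ ($i\ge4$), and $H(X,Y,q)=\sum_{i=1}^{p+3}a_i(q)X^{m_i}Y^{n_i}$. Let $X_P$ be the projective toric surface of $P$, $\mathbb{R}X_P$ the closure of $(\mathbb{R}^* )^2$ in $X_P$; for each side $r_i$ of $P$ the axis $l_i$ is the real part of the torus-invariant boundary divisor of $X_P$ corresponding to $r_i$. The integer length $d_i$ of $r_i$ is the number of lattice points on $r_i$ minus one. The real mirror curve is $\{(x,y)\in(\mathbb{R}^* )^2:H(x,y,q)=0\}$; the unbounded component $W$ is the connected component of its closure in $\mathbb{R}X_P$ that meets the union of the axes (in this setting there is exactly one such component). *)

theory Defs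
  imports "HOL-Analysis.Analysis"
begin

text \<open>Conventions. Lattice points of P are indexed 0-based: b i = (m i, n i) for i < N,
  N = p + 3, with b 0 = (1,0), b 1 = (0,1), b 2 = (0,0) (the paper's b_1, b_2, b_3).
  The Kaehler parameters q are indexed by k < p.\<close>

definition lpt :: "(nat \<Rightarrow> int) \<Rightarrow> (nat \<Rightarrow> int) \<Rightarrow> nat \<Rightarrow> real \<times> real" where
  "lpt m n i = (real_of_int (m i), real_of_int (n i))"

definition is_lattice_point :: "real \<times> real \<Rightarrow> bool" where
  "is_lattice_point z \<longleftrightarrow> fst z \<in> \<int> \<and> snd z \<in> \<int>"

definition polygon :: "nat \<Rightarrow> (nat \<Rightarrow> int) \<Rightarrow> (nat \<Rightarrow> int) \<Rightarrow> (real \<times> real) set" where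
  "polygon N m n = convex hull (lpt m n ` {..<N})"

definition twice_area :: "(nat \<Rightarrow> int) \<Rightarrow> (nat \<Rightarrow> int) \<Rightarrow> nat \<Rightarrow> nat \<Rightarrow> nat \<Rightarrow> int" where
  "twice_area m n i j k = \<bar>(m j - m i) * (n k - n i) - (m k - m i) * (n j - n i)\<bar>"

definition unimodular_triangulation ::
  "nat \<Rightarrow> (nat \<Rightarrow> int) \<Rightarrow> (nat \<Rightarrow> int) \<Rightarrow> nat set set \<Rightarrow> bool" where
  "unimodular_triangulation N m n T \<longleftrightarrow>
     finite T \<and>
     (\<forall>\<sigma>\<in>T. \<sigma> \<subseteq> {..<N} \<and> card \<sigma> = 3) \<and>
     (\<forall>\<sigma>\<in>T. \<forall>i j k. \<sigma> = {i, j, k} \<longrightarrow> twice_area m n i j k = 1) \<and>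
     (\<Union>\<sigma>\<in>T. convex hull (lpt m n ` \<sigma>)) = polygon N m n \<and>
     (\<forall>\<sigma>\<in>T. \<forall>\<tau>\<in>T. convex hull (lpt m n ` \<sigma>) \<inter> convex hull (lpt m n ` \<tau>)
                        = convex hull (lpt m n ` (\<sigma> \<inter> \<tau>))) \<and>
     \<Union>T = {..<N}"

definition charge_lattice :: "nat \<Rightarrow> (nat \<Rightarrow> int) \<Rightarrow> (nat \<Rightarrow> int) \<Rightarrow> (nat \<Rightarrow> int) set" where
  "charge_lattice N m n = {l. (\<forall>i\<ge>N. l i = 0) \<and> (\<Sum>i<N. l i * m i) = 0 \<and>
                              (\<Sum>i<N. l i * n i) = 0 \<and> (\<Sum>i<N. l i) = 0}"

text \<open>Coefficients a_i(q) of the mirror curve (sigma_1 = {0,1,2}).\<close>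
definition mirror_coeff :: "nat \<Rightarrow> (nat set \<Rightarrow> nat \<Rightarrow> nat \<Rightarrow> nat) \<Rightarrow> nat \<Rightarrow> (nat \<Rightarrow> real) \<Rightarrow> real" where
  "mirror_coeff p s i q = (if i < 3 then 1 else (\<Prod>k<p. q k ^ s {0, 1, 2} k i))"

definition mirror_poly ::
  "nat \<Rightarrow> (nat \<Rightarrow> int) \<Rightarrow> (nat \<Rightarrow> int) \<Rightarrow> (nat set \<Rightarrow> nat \<Rightarrow> nat \<Rightarrow> nat) \<Rightarrow> (nat \<Rightarrow> real)
     \<Rightarrow> real \<Rightarrow> real \<Rightarrow> real" where
  "mirror_poly p m n s q x y = (\<Sum>i<p+3. mirror_coeff p s i q * x powi m i * y powi n i)"

text \<open>A point of RP^(N-1) is a line through the origin minus 0 in R^N (R^N realised as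
  nat \<Rightarrow> real supported on {..<N}, as in Euclidean_space).\<close>
definition line_of :: "(nat \<Rightarrow> real) \<Rightarrow> (nat \<Rightarrow> real) set" where
  "line_of v = {(\<lambda>i. c * v i) | c. c \<noteq> 0}"

definition proj_points :: "nat \<Rightarrow> (nat \<Rightarrow> real) set set" where
  "proj_points N = line_of ` (topspace (Euclidean_space N) - {\<lambda>i. 0})"

definition proj_space :: "nat \<Rightarrow> (nat \<Rightarrow> real) set topology" where
  "proj_space N = topology (\<lambda>U. U \<subseteq> proj_points N \<and>
      openin (Euclidean_space N) {v \<in> topspace (Euclidean_space N). v \<noteq> (\<lambda>i. 0) \<and> line_of v \<in> U})"

text \<open>Monomial map (R^*)^2 \<rightarrow> R^N; composed with line_of it is the embedding of the
  real torus into X_P \<subseteq> RP^(N-1) given by all lattice points of P.\<close>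
definition monomial_map :: "nat \<Rightarrow> (nat \<Rightarrow> int) \<Rightarrow> (nat \<Rightarrow> int) \<Rightarrow> real \<Rightarrow> real \<Rightarrow> nat \<Rightarrow> real" where
  "monomial_map N m n x y = (\<lambda>i. if i < N then x powi m i * y powi n i else 0)"

definition real_toric_surface :: "nat \<Rightarrow> (nat \<Rightarrow> int) \<Rightarrow> (nat \<Rightarrow> int) \<Rightarrow> (nat \<Rightarrow> real) set set" where
  "real_toric_surface N m n = proj_space N closure_of
     {line_of (monomial_map N m n x y) | x y. x \<noteq> 0 \<and> y \<noteq> 0}"

definition is_side :: "(real \<times> real) set \<Rightarrow> (real \<times> real) set \<Rightarrow> bool" where
  "is_side P F \<longleftrightarrow> F face_of P \<and> aff_dim F = 1"

definition side_indices :: "nat \<Rightarrow> (nat \<Rightarrow> int) \<Rightarrow> (nat \<Rightarrow> int) \<Rightarrow> (real \<times> real) set \<Rightarrow> nat set" where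
  "side_indices N m n F = {i. i < N \<and> lpt m n i \<in> F}"

definition integer_length :: "nat \<Rightarrow> (nat \<Rightarrow> int) \<Rightarrow> (nat \<Rightarrow> int) \<Rightarrow> (real \<times> real) set \<Rightarrow> nat" where
  "integer_length N m n F = card (side_indices N m n F) - 1"

text \<open>The axis l_F: real part of the torus-invariant divisor of X_P corresponding to the
  side F, i.e. the points of R X_P whose homogeneous coordinates vanish off F.\<close>
definition axis :: "nat \<Rightarrow> (nat \<Rightarrow> int) \<Rightarrow> (nat \<Rightarrow> int) \<Rightarrow> (real \<times> real) set \<Rightarrow> (nat \<Rightarrow> real) set set" where
  "axis N m n F = {z \<in> real_toric_surface N m n.
                     \<forall>v\<in>z. \<forall>i<N. i \<notin> side_indices N m n F \<longrightarrow> v i = 0}"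

definition mirror_curve_closure ::
  "nat \<Rightarrow> (nat \<Rightarrow> int) \<Rightarrow> (nat \<Rightarrow> int) \<Rightarrow> (nat set \<Rightarrow> nat \<Rightarrow> nat \<Rightarrow> nat) \<Rightarrow> (nat \<Rightarrow> real)
     \<Rightarrow> (nat \<Rightarrow> real) set set" where
  "mirror_curve_closure p m n s q = proj_space (p+3) closure_of
     {line_of (monomial_map (p+3) m n x y) | x y. x \<noteq> 0 \<and> y \<noteq> 0 \<and> mirror_poly p m n s q x y = 0}"

definition all_axes :: "nat \<Rightarrow> (nat \<Rightarrow> int) \<Rightarrow> (nat \<Rightarrow> int) \<Rightarrow> (nat \<Rightarrow> real) set set" where
  "all_axes N m n = \<Union>{axis N m n F | F. is_side (polygon N m n) F}"

definition unbounded_component ::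
  "nat \<Rightarrow> (nat \<Rightarrow> int) \<Rightarrow> (nat \<Rightarrow> int) \<Rightarrow> (nat set \<Rightarrow> nat \<Rightarrow> nat \<Rightarrow> nat) \<Rightarrow> (nat \<Rightarrow> real)
     \<Rightarrow> (nat \<Rightarrow> real) set set \<Rightarrow> bool" where
  "unbounded_component p m n s q W \<longleftrightarrow>
     W \<in> connected_components_of (subtopology (proj_space (p+3)) (mirror_curve_closure p m n s q)) \<and>
     W \<inter> all_axes (p+3) m n \<noteq> {}"

end

theory Submission
  imports Defs
begin

text \<open>For small \<open>q\<close> the expansions of the \<open>H k\<close> over the triangles say that the triangulation is regular
  with respect to the heights \<open>ln \<bar>a i\<bar>\<close>, with a large gap: every
  other \<open>\<bar>a i\<bar>\<close> is at most \<open>\<epsilon>\<close> times the value interpolated from the vertices of a triangle. This is the situation of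
  Viro's patchworking, with Harnack's signs: each lattice point \<open>v\<close> has a quadrant in which the monomials of
  the sign of \<open>v\<close> are exactly those congruent to \<open>v\<close> modulo 2, so that \<open>v\<close> is isolated from all its
  neighbours in the triangulation.

  Take \<open>v\<close> on the boundary of the polygon. In logarithmic coordinates, near \<open>v\<close> the curve in this quadrant
  is \<open>\<Phi> = 0\<close>, where \<open>\<Phi>\<close> is a sum of exponentials minus a negligible part, convex on a convex region
  and decreasing along a normal vector of a side at \<open>v\<close>. Hence this piece of the curve is connected, as
  the image of the convex set \<open>\<Phi> < 0\<close>. For each unit boundary edge at \<open>v\<close>, its closure contains a point of the
  corresponding axis at which the two monomials of the edge are comparable and dominate all others. A side of
  integer length \<open>d\<close> has \<open>d\<close> unit edges, hence at least \<open>d\<close> such points, while the points of the curve on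
  the axis are roots of a polynomial of degree \<open>d\<close>. So there are exactly \<open>d\<close>, one for each
  edge. The pieces of the curve at the two vertices of an edge therefore meet in the point of this edge, and
  since the boundary of the polygon is connected, all these points lie in one component.\<close>

section \<open>The topology of projective space\<close>

lemma openin_Euclidean_space_iff:
  "openin (Euclidean_space N) S \<longleftrightarrow> (\<exists>T. open T \<and> S = T \<inter> topspace (Euclidean_space N))"
  unfolding topspace_Euclidean_space
  by (simp add: Euclidean_space_def openin_subtopology euclidean_product_topology)

lemma openin_proj_space:
  "openin (proj_space N) U \<longleftrightarrow> U \<subseteq> proj_points N \<and>
    openin (Euclidean_space N)
      {v \<in> topspace (Euclidean_space N). v \<noteq> (\<lambda>i. 0) \<and> line_of v \<in> U}"
proof -
  let ?P = "\<lambda>U. {v \<in> topspace (Euclidean_space N). v \<noteq> (\<lambda>i. 0) \<and> line_of v \<in> U}"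
  have "istopology (\<lambda>U. U \<subseteq> proj_points N \<and> openin (Euclidean_space N) (?P U))"
    unfolding istopology_def
  proof (intro conjI allI impI)
    fix U V assume U: "U \<subseteq> proj_points N \<and> openin (Euclidean_space N) (?P U)"
      and V: "V \<subseteq> proj_points N \<and> openin (Euclidean_space N) (?P V)"
    show "U \<inter> V \<subseteq> proj_points N" using U by blast
    have "?P (U \<inter> V) = ?P U \<inter> ?P V" by blast
    then show "openin (Euclidean_space N) (?P (U \<inter> V))" using U V by (simp add: openin_Int)
  next
    fix \<K> assume K: "\<forall>U\<in>\<K>. U \<subseteq> proj_points N \<and> openin (Euclidean_space N) (?P U)"
    show "\<Union>\<K> \<subseteq> proj_points N" using K by blast
    have "?P (\<Union>\<K>) = (\<Union>U\<in>\<K>. ?P U)" by blast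
    then show "openin (Euclidean_space N) (?P (\<Union>\<K>))" using K by (force intro: openin_Union)
  qed
  then show ?thesis unfolding proj_space_def by (simp add: topology_inverse')
qed

lemma self_in_line_of: "v \<in> line_of v"
  unfolding line_of_def by (auto intro!: exI[of _ 1])

lemma line_of_scale: "c \<noteq> 0 \<Longrightarrow> line_of (\<lambda>i. c * v i) = line_of v"
proof -
  assume c: "c \<noteq> 0"
  have "(\<lambda>i. d * (c * v i)) \<in> line_of v" if "d \<noteq> 0" for d
    unfolding line_of_def using that c by (auto intro!: exI[of _ "d * c"])
  moreover have "(\<lambda>i. d * v i) \<in> line_of (\<lambda>i. c * v i)" if "d \<noteq> 0" for d
    unfolding line_of_def using that c by (auto intro!: exI[of _ "d / c"])
  ultimately show ?thesis unfolding line_of_def by fast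
qed

lemma open_nonzero: "openin (Euclidean_space N) (topspace (Euclidean_space N) - {\<lambda>i. 0})"
proof -
  have "topspace (Euclidean_space N) - {\<lambda>i. 0} = (- {\<lambda>i. 0}) \<inter> topspace (Euclidean_space N)"
    by blast
  then show ?thesis unfolding openin_Euclidean_space_iff by (metis closed_singleton open_Compl)
qed

lemma topspace_proj_space [simp]: "topspace (proj_space N) = proj_points N"
proof
  show "topspace (proj_space N) \<subseteq> proj_points N"
    using openin_proj_space openin_topspace by blast
  have "{v \<in> topspace (Euclidean_space N). v \<noteq> (\<lambda>i. 0) \<and> line_of v \<in> proj_points N}
      = topspace (Euclidean_space N) - {\<lambda>i. 0}"
    unfolding proj_points_def by blast
  then have "openin (proj_space N) (proj_points N)"
    unfolding openin_proj_space using open_nonzero by auto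
  then show "proj_points N \<subseteq> topspace (proj_space N)" by (rule openin_subset)
qed

text \<open>Since scaling preserves zeros, the condition does not depend on the representative, and
  the complement pulls back to an open set of nonzero vectors. Asking only that zeros be preserved
  covers forms of every degree.\<close>

lemma closedin_homogeneous:
  fixes f :: "(nat \<Rightarrow> real) \<Rightarrow> real"
  assumes cont: "continuous_on UNIV f"
    and hom: "\<And>c v. c \<noteq> 0 \<Longrightarrow> f (\<lambda>i. c * v i) = 0 \<longleftrightarrow> f v = 0"
  shows "closedin (proj_space N) {z \<in> proj_points N. \<forall>v\<in>z. f v = 0}"
proof -
  have zero_line: "(\<forall>w\<in>line_of v. f w = 0) \<longleftrightarrow> f v = 0" for v
    using hom self_in_line_of[of v] unfolding line_of_def by auto
  have eq: "{v \<in> topspace (Euclidean_space N). v \<noteq> (\<lambda>i. 0) \<and>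
        line_of v \<in> proj_points N - {z \<in> proj_points N. \<forall>v\<in>z. f v = 0}}
     = f -` (- {0}) \<inter> (- {\<lambda>i. 0}) \<inter> topspace (Euclidean_space N)"
    using zero_line by (auto simp: proj_points_def)
  have "open (f -` (- {0}))" using cont by (intro open_vimage) auto
  then have "open (f -` (- {0}) \<inter> (- {\<lambda>i. 0}))" by (intro open_Int) (auto simp: open_Compl)
  then have "openin (proj_space N) (proj_points N - {z \<in> proj_points N. \<forall>v\<in>z. f v = 0})"
    unfolding openin_proj_space eq openin_Euclidean_space_iff by blast
  then show ?thesis unfolding closedin_def by auto
qed

text \<open>The device that carries equations from torus points to limit points: a linear form for
  the curve, binomials for the toric surface.\<close>

lemma closure_homogeneous:
  fixes f :: "(nat \<Rightarrow> real) \<Rightarrow> real"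
  assumes "continuous_on UNIV f"
    and hom: "\<And>c v. c \<noteq> 0 \<Longrightarrow> f (\<lambda>i. c * v i) = 0 \<longleftrightarrow> f v = 0"
    and "\<And>z. z \<in> S \<Longrightarrow> \<exists>v. z = line_of v \<and> z \<in> proj_points N \<and> f v = 0"
    and "z \<in> proj_space N closure_of S" and "v \<in> z"
  shows "f v = 0"
proof -
  have "S \<subseteq> {z \<in> proj_points N. \<forall>v\<in>z. f v = 0}"
    using assms(3) hom unfolding line_of_def by fastforce
  then have "proj_space N closure_of S \<subseteq> {z \<in> proj_points N. \<forall>v\<in>z. f v = 0}"
    using closedin_homogeneous[OF assms(1) hom] by (simp add: closure_of_minimal)
  then show ?thesis using assms(4,5) by blast
qed

text \<open>Produces points outside the torus. Coordinatewise convergence is convergence in the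
  product topology, where the cone over a neighbourhood is relatively open.\<close>

lemma line_of_limit_in_closure:
  assumes V: "V \<in> topspace (Euclidean_space N)" "V \<noteq> (\<lambda>i. 0)"
    and lim: "\<And>i. (\<lambda>k::nat. X k i) \<longlonglongrightarrow> V i"
    and X: "\<And>k. X k \<in> topspace (Euclidean_space N)" "\<And>k. line_of (X k) \<in> S"
  shows "line_of V \<in> proj_space N closure_of S"
  unfolding in_closure_of
proof (intro conjI allI impI)
  show "line_of V \<in> topspace (proj_space N)" using V by (simp add: proj_points_def)
  fix U assume U: "line_of V \<in> U \<and> openin (proj_space N) U"
  then obtain T where T: "open T" "{v \<in> topspace (Euclidean_space N). v \<noteq> (\<lambda>i. 0) \<and> line_of v \<in> U}
      = T \<inter> topspace (Euclidean_space N)"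
    unfolding openin_proj_space openin_Euclidean_space_iff by blast
  have "V \<in> T" using T V U by blast
  moreover have "X \<longlonglongrightarrow> V" using lim
    by (simp add: limitin_componentwise flip: limitin_canonical_iff euclidean_product_topology)
  ultimately have "eventually (\<lambda>k. X k \<in> T) sequentially" using T(1) by (simp add: topological_tendstoD)
  then obtain k where "X k \<in> T" by (auto dest: eventually_happens)
  then have "line_of (X k) \<in> U" using T(2) X(1) by blast
  then show "\<exists>y. y \<in> S \<and> y \<in> U" using X(2) by blast
qed

lemma continuous_map_line_of:
  fixes f :: "'a::topological_space \<Rightarrow> nat \<Rightarrow> real"
  assumes "\<And>i. continuous_on UNIV (\<lambda>u. f u i)"
    and f: "\<And>u. f u \<in> topspace (Euclidean_space N)" "\<And>u. f u \<noteq> (\<lambda>i. 0)"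
  shows "continuous_map euclidean (proj_space N) (\<lambda>u. line_of (f u))"
  unfolding continuous_map_def
proof (intro conjI allI impI)
  show "(\<lambda>u. line_of (f u)) \<in> topspace euclidean \<rightarrow> topspace (proj_space N)"
    using f by (auto simp: proj_points_def)
  fix U assume "openin (proj_space N) U"
  then obtain T where T: "open T" "{v \<in> topspace (Euclidean_space N). v \<noteq> (\<lambda>i. 0) \<and> line_of v \<in> U}
      = T \<inter> topspace (Euclidean_space N)"
    unfolding openin_proj_space openin_Euclidean_space_iff by blast
  have "continuous_on UNIV f"
    using assms(1) by (simp add: continuous_on_coordinatewise_then_product)
  then have "open (f -` T)" using T(1) by (simp add: open_vimage)
  moreover have "{u \<in> topspace euclidean. line_of (f u) \<in> U} = f -` T"
    using T(2) f by auto
  ultimately show "openin euclidean {u \<in> topspace euclidean. line_of (f u) \<in> U}" by simp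
qed

section \<open>Size of the coefficients of the mirror curve\<close>

text \<open>Gaussian elimination by induction on the equations: a pivot removes one equation
  together with one unknown.\<close>

lemma nontrivial_solution:
  fixes f :: "'k \<Rightarrow> 'j \<Rightarrow> 'a::field"
  assumes "finite J" "finite K" "card J < card K"
  shows "\<exists>c. (\<exists>k\<in>K. c k \<noteq> 0) \<and> (\<forall>j\<in>J. (\<Sum>k\<in>K. c k * f k j) = 0)"
  using assms
proof (induction J arbitrary: K f rule: finite_induct)
  case empty
  then have "K \<noteq> {}" by auto
  then show ?case by (intro exI[of _ "\<lambda>_. 1"]) auto
next
  case (insert j0 J)
  show ?case
  proof (cases "\<forall>k\<in>K. f k j0 = 0")
    case True
    from insert have "card J < card K" by simp
    then show ?thesis using insert.IH[OF insert.prems(1), of f] True by auto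
  next
    case False
    then obtain k0 where k0: "k0 \<in> K" "f k0 j0 \<noteq> 0" by blast
    \<comment> \<open>The vectors \<open>f k\<close> with a multiple of the pivot vector
      \<open>f k0\<close> subtracted so as to clear their entry at \<open>j0\<close>.\<close>
    define g where "g k j = f k j - f k j0 / f k0 j0 * f k0 j" for k j
    have "card J < card (K - {k0})" using insert k0 by simp
    then obtain c where c: "\<exists>k\<in>K - {k0}. c k \<noteq> 0" "\<forall>j\<in>J. (\<Sum>k\<in>K - {k0}. c k * g k j) = 0"
      using insert.IH[of "K - {k0}" g] insert.prems by auto
    let ?S = "\<Sum>k\<in>K - {k0}. c k * f k j0"
    define d where "d = c(k0 := - ?S / f k0 j0)"
    have sum_d: "(\<Sum>k\<in>K. d k * f k j) = - ?S / f k0 j0 * f k0 j + (\<Sum>k\<in>K - {k0}. c k * f k j)" for j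
      using k0 insert.prems by (simp add: sum.remove[of K k0] d_def)
    have "(\<Sum>k\<in>K. d k * f k j) = (\<Sum>k\<in>K - {k0}. c k * g k j)" for j
      unfolding sum_d g_def
      by (simp add: algebra_simps sum_subtractf sum_distrib_left sum_distrib_right sum_divide_distrib)
    moreover have "(\<Sum>k\<in>K. d k * f k j0) = 0" using k0 by (simp add: sum_d)
    moreover have "\<exists>k\<in>K. d k \<noteq> 0" using c(1) by (auto simp: d_def)
    ultimately show ?thesis using c(2) by (intro exI[of _ d]) simp
  qed
qed

text \<open>The matrix is square of size \<open>p\<close>. A zero column would leave
  \<open>p - 1\<close> equations in \<open>p\<close> unknowns, and a nontrivial solution contradicts
  nondegeneracy.\<close>

lemma nondegenerate_column_nonzero:
  fixes s :: "nat \<Rightarrow> nat \<Rightarrow> nat"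
  assumes nondeg: "\<forall>c :: nat \<Rightarrow> rat. (\<forall>j\<in>{..<p+3} - \<sigma>. (\<Sum>k<p. c k * of_nat (s k j)) = 0)
      \<longrightarrow> (\<forall>k<p. c k = 0)"
    and \<sigma>: "\<sigma> \<subseteq> {..<p+3}" "card \<sigma> = 3" and w: "w \<in> {..<p+3} - \<sigma>"
  shows "\<exists>k<p. s k w \<noteq> 0"
proof (rule ccontr)
  assume zero: "\<not> ?thesis"
  have "finite \<sigma>" using \<sigma> by (simp add: finite_subset)
  then have "card ({..<p+3} - \<sigma>) = p" using \<sigma> by (simp add: card_Diff_subset)
  then have "card ({..<p+3} - \<sigma> - {w}) < card {..<p}"
    using w by (metis card_Diff1_less card_lessThan finite_Diff finite_lessThan)
  then obtain c :: "nat \<Rightarrow> rat" where c: "\<exists>k\<in>{..<p}. c k \<noteq> 0"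
      "\<forall>j\<in>{..<p+3} - \<sigma> - {w}. (\<Sum>k<p. c k * of_nat (s k j)) = 0"
    using nontrivial_solution[of "{..<p+3} - \<sigma> - {w}" "{..<p}" "\<lambda>k j. of_nat (s k j) :: rat"] by auto
  have "(\<Sum>k<p. c k * of_nat (s k w)) = 0" using zero by simp
  then have "\<forall>j\<in>{..<p+3} - \<sigma>. (\<Sum>k<p. c k * of_nat (s k j)) = 0" using c(2) by auto
  then show False using nondeg c(1) by auto
qed

lemma ln_abs_mirror_coeff:
  assumes "\<forall>k<p. q k \<noteq> 0"
  shows "ln \<bar>mirror_coeff p s i q\<bar> = (if i < 3 then 0 else (\<Sum>k<p. s {0,1,2} k i * ln \<bar>q k\<bar>))"
  using assms by (auto simp: mirror_coeff_def abs_prod power_abs ln_realpow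
      intro!: trans[OF ln_prod] sum.cong)

lemma sum_four_support:
  fixes g :: "nat \<Rightarrow> 'a::comm_ring_1"
  assumes "finite A" "{w, v, i, j} \<subseteq> A" "distinct [w, v, i, j]"
  shows "(\<Sum>x\<in>A. (if x = w then a else if x = v then b else if x = i then c else if x = j then d else 0) * g x)
    = a * g w + b * g v + c * g i + d * g j"
proof -
  have "(\<Sum>x\<in>A. (if x = w then a else if x = v then b else if x = i then c else if x = j then d else 0) * g x)
    = (\<Sum>x\<in>{w, v, i, j}. (if x = w then a else if x = v then b else if x = i then c else if x = j then d else 0) * g x)"
    using assms by (intro sum.mono_neutral_right) auto
  also have "\<dots> = a * g w + b * g v + c * g i + d * g j" using assms(3) by (auto simp: algebra_simps)
  finally show ?thesis .
qed

text \<open>The affine relation between \<open>w\<close> and the vertices of a triangle lies in the charge lattice.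
  Its monomial in the coefficients, computed with the expansion of the \<open>H k\<close> in the basis of that
  triangle, is a nontrivial monomial in the parameters \<open>q\<close>.\<close>
lemma mirror_coeff_dominated:
  fixes H :: "nat \<Rightarrow> (nat \<Rightarrow> int) \<Rightarrow> rat" and al be :: int and L :: "nat \<Rightarrow> real"
  assumes sigma1: "{0, 1, 2} \<in> T" and vij: "{v, i, j} \<in> T" "card {v, i, j} = 3" "{v, i, j} \<subseteq> {..<p+3}"
    and H_expansion: "\<forall>\<sigma>\<in>T. \<forall>k<p. \<forall>l\<in>charge_lattice (p+3) m n.
             H k l = of_int (\<Sum>j\<in>{..<p+3} - \<sigma>. int (s \<sigma> k j) * l j)"
    and s_nondeg: "\<forall>\<sigma>\<in>T. \<forall>c :: nat \<Rightarrow> rat.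
             (\<forall>j\<in>{..<p+3} - \<sigma>. (\<Sum>k<p. c k * of_nat (s \<sigma> k j)) = 0) \<longrightarrow> (\<forall>k<p. c k = 0)"
    and w: "w < p + 3" "w \<notin> {v, i, j}"
    and coords: "m w - m v = al * (m i - m v) + be * (m j - m v)"
      "n w - n v = al * (n i - n v) + be * (n j - n v)"
    and q: "\<forall>k<p. q k \<noteq> 0 \<and> \<bar>q k\<bar> < \<epsilon>" and \<epsilon>: "0 < \<epsilon>" "\<epsilon> \<le> 1"
  defines "L \<equiv> \<lambda>i::nat. ln \<bar>mirror_coeff p s i q\<bar>"
  shows "L w - L v \<le> ln \<epsilon> + al * (L i - L v) + be * (L j - L v)"
proof -
  define l :: "nat \<Rightarrow> int" where "l = (\<lambda>x. if x = w then 1 else if x = v then al + be - 1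
      else if x = i then - al else if x = j then - be else 0)"
  have dist: "distinct [w, v, i, j]"
    using vij(2) w by (auto simp: card_insert_if split: if_splits)
  have "(\<Sum>x<p+3. l x * m x) = m w + (al + be - 1) * m v - al * m i - be * m j"
      "(\<Sum>x<p+3. l x * n x) = n w + (al + be - 1) * n v - al * n i - be * n j"
    unfolding l_def using vij(3) w(1) dist by (subst sum_four_support; simp)+
  moreover have "(\<Sum>x<p+3. l x * 1) = 0"
    unfolding l_def using vij(3) w(1) dist by (subst sum_four_support) auto
  moreover have "\<forall>x\<ge>p+3. l x = 0" using vij(3) w(1) by (auto simp: l_def)
  ultimately have l: "l \<in> charge_lattice (p+3) m n"
    using coords by (auto simp: charge_lattice_def algebra_simps)
  have expand: "(\<Sum>x\<in>{..<p+3} - {0,1,2}. int (s {0,1,2} k x) * l x) = int (s {v,i,j} k w)"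
    if k: "k < p" for k
  proof -
    have "(\<Sum>x\<in>{..<p+3} - {0,1,2}. int (s {0,1,2} k x) * l x)
        = (\<Sum>x\<in>{..<p+3} - {v,i,j}. int (s {v,i,j} k x) * l x)"
      using H_expansion[rule_format, OF sigma1 k l] H_expansion[rule_format, OF vij(1) k l]
      by (simp only: of_int_eq_iff)
    \<comment> \<open>Off the triangle the relation \<open>l\<close> is supported at
      \<open>w\<close> alone, where it equals 1.\<close>
    also have "\<dots> = (\<Sum>x\<in>{w}. int (s {v,i,j} k x) * l x)"
      using w by (intro sum.mono_neutral_right) (auto simp: l_def)
    finally show ?thesis by (simp add: l_def)
  qed
  have split: "{..<p+3} - {0,1,2::nat} = {x\<in>{..<p+3}. \<not> x < 3}" by auto
  have "(\<Sum>x<p+3. real_of_int (l x) * L x)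
      = (\<Sum>x\<in>{..<p+3} - {0,1,2}. real_of_int (l x) * (\<Sum>k<p. s {0,1,2} k x * ln \<bar>q k\<bar>))"
    unfolding L_def split using q
    by (subst sum.inter_filter) (auto intro!: sum.cong simp: ln_abs_mirror_coeff)
  also have "\<dots> = (\<Sum>k<p. (\<Sum>x\<in>{..<p+3} - {0,1,2}. int (s {0,1,2} k x) * l x) * ln \<bar>q k\<bar>)"
    by (simp add: sum_distrib_left sum_distrib_right mult_ac) (rule sum.swap)
  also have "\<dots> = (\<Sum>k<p. s {v,i,j} k w * ln \<bar>q k\<bar>)"
    using expand by (intro sum.cong) simp_all
  also have "\<dots> \<le> ln \<epsilon>"
  proof -
    have qneg: "ln \<bar>q k\<bar> < ln \<epsilon>" if "k < p" for k using q that \<epsilon> by simp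
    have "ln \<epsilon> \<le> 0" using \<epsilon> by simp
    then have le: "s {v,i,j} k w * ln \<bar>q k\<bar> \<le> 0" if "k < p" for k
      using qneg[OF that] by (simp add: mult_nonneg_nonpos)
    \<comment> \<open>All summands are nonpositive, so one exponent that is at least 1 bounds the
      whole sum by \<open>ln \<epsilon>\<close>.\<close>
    obtain k where k: "k < p" "s {v,i,j} k w \<noteq> 0"
      using nondegenerate_column_nonzero[of p "{v,i,j}" "s {v,i,j}" w] s_nondeg vij w by auto
    have "(\<Sum>k<p. s {v,i,j} k w * ln \<bar>q k\<bar>) \<le> (\<Sum>k\<in>{k}. s {v,i,j} k w * ln \<bar>q k\<bar>)"
      using k(1) le by (subst sum.remove[of _ k]) (auto intro!: sum_nonpos)
    also have "\<dots> \<le> 1 * ln \<bar>q k\<bar>"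
      using k qneg[OF k(1)] \<open>ln \<epsilon> \<le> 0\<close> by (auto intro!: mult_right_mono_neg)
    finally show ?thesis using qneg[OF k(1)] by simp
  qed
  finally have "(\<Sum>x<p+3. real_of_int (l x) * L x) \<le> ln \<epsilon>" .
  moreover have "(\<Sum>x<p+3. real_of_int (l x) * L x) = L w + (al + be - 1) * L v - al * L i - be * L j"
  proof -
    have "(\<Sum>x<p+3. real_of_int (l x) * L x) = (\<Sum>x<p+3. (if x = w then 1 else
        if x = v then real_of_int (al + be - 1) else if x = i then - real_of_int al
        else if x = j then - real_of_int be else 0) * L x)"
      by (intro sum.cong) (simp_all add: l_def)
    also have "\<dots> = L w + (al + be - 1) * L v - al * L i - be * L j"
      using vij(3) w(1) dist by (subst sum_four_support) auto
    finally show ?thesis .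
  qed
  ultimately show ?thesis by (simp add: algebra_simps)
qed

section \<open>Unimodular triangulations\<close>

text \<open>The signed form of \<open>twice_area\<close>; the sign is kept because Cramer's rule
  needs it.\<close>

definition ldet :: "(nat \<Rightarrow> int) \<Rightarrow> (nat \<Rightarrow> int) \<Rightarrow> nat \<Rightarrow> nat \<Rightarrow> nat \<Rightarrow> int" where
  "ldet m n v i j = (m i - m v) * (n j - n v) - (m j - m v) * (n i - n v)"

text \<open>In a unimodular triangle \<open>v i j\<close> this is the coefficient of \<open>b i - b v\<close> in \<open>b w - b v\<close>
  (Cramer's rule, the determinant being its own inverse); that of \<open>b j - b v\<close> is
  \<open>bcoord m n v j i w\<close>.\<close>
definition bcoord :: "(nat \<Rightarrow> int) \<Rightarrow> (nat \<Rightarrow> int) \<Rightarrow> nat \<Rightarrow> nat \<Rightarrow> nat \<Rightarrow> nat \<Rightarrow> int" where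
  "bcoord m n v i j w = ldet m n v i j * ldet m n v w j"

locale lattice_triangulation =
  fixes N :: nat and m n :: "nat \<Rightarrow> int" and T :: "nat set set"
  assumes b_distinct: "inj_on (lpt m n) {..<N}"
    and N_positive: "0 < N"
    and b_lattice: "\<And>z. z \<in> polygon N m n \<Longrightarrow> is_lattice_point z \<longleftrightarrow> (\<exists>i<N. z = lpt m n i)"
    and triang: "unimodular_triangulation N m n T"
begin

abbreviation b :: "nat \<Rightarrow> real \<times> real" where "b \<equiv> lpt m n"

definition tri :: "nat \<Rightarrow> nat \<Rightarrow> nat \<Rightarrow> bool" where
  "tri v i j \<longleftrightarrow> {v, i, j} \<in> T \<and> distinct [v, i, j]"

lemma tri_swap: "tri v i j \<Longrightarrow> tri v j i" "tri v i j \<Longrightarrow> tri i v j" "tri v i j \<Longrightarrow> tri i j v"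
    "tri v i j \<Longrightarrow> tri j i v" "tri v i j \<Longrightarrow> tri j v i"
  unfolding tri_def by (auto simp: insert_commute)

lemma triangulationD:
  shows "finite T" "\<sigma> \<in> T \<Longrightarrow> \<sigma> \<subseteq> {..<N}" "\<sigma> \<in> T \<Longrightarrow> card \<sigma> = 3" "\<Union>T = {..<N}"
    "{v, i, j} \<in> T \<Longrightarrow> twice_area m n v i j = 1"
    "polygon N m n = (\<Union>\<sigma>\<in>T. convex hull (b ` \<sigma>))"
    "\<sigma> \<in> T \<Longrightarrow> \<tau> \<in> T \<Longrightarrow>
      convex hull (b ` \<sigma>) \<inter> convex hull (b ` \<tau>) = convex hull (b ` (\<sigma> \<inter> \<tau>))"
  using triang unfolding unimodular_triangulation_def by simp_all

lemma tri_less: "tri v i j \<Longrightarrow> v < N" "tri v i j \<Longrightarrow> i < N" "tri v i j \<Longrightarrow> j < N"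
  using triangulationD(2) unfolding tri_def by blast+

lemma tri_card: "tri v i j \<Longrightarrow> card {v, i, j} = 3"
  unfolding tri_def by auto

lemma tri_obtain:
  assumes "\<sigma> \<in> T" "v \<in> \<sigma>"
  obtains i j where "\<sigma> = {v, i, j}" "tri v i j"
proof -
  have "card \<sigma> = 3" using triangulationD(3) assms by blast
  then have "card (\<sigma> - {v}) = 2" using assms(2) by simp
  then obtain i j where ij: "\<sigma> - {v} = {i, j}" "i \<noteq> j" by (auto simp: card_2_iff)
  then have "\<sigma> = {v, i, j}" using assms(2) by blast
  moreover have "tri v i j" unfolding tri_def using calculation ij assms(1) by auto
  ultimately show ?thesis using that by blast
qed

lemma vertex_in_tri:
  assumes "v < N" obtains i j where "tri v i j"
proof -
  have "v \<in> \<Union>T" using triangulationD(4) assms by simp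
  then show ?thesis using tri_obtain that by (metis UnionE)
qed

lemma ldet_tri: "tri v i j \<Longrightarrow> ldet m n v i j = 1 \<or> ldet m n v i j = - 1"
proof -
  assume "tri v i j"
  then have "twice_area m n v i j = 1"
    using triangulationD(5) unfolding tri_def by simp
  then show ?thesis unfolding twice_area_def ldet_def by linarith
qed

lemma ldet_tri_square: "tri v i j \<Longrightarrow> ldet m n v i j * ldet m n v i j = 1"
  using ldet_tri by fastforce

lemma bcoord_eq:
  assumes "tri v i j"
  shows "m w - m v = bcoord m n v i j w * (m i - m v) + bcoord m n v j i w * (m j - m v)"
    and "n w - n v = bcoord m n v i j w * (n i - n v) + bcoord m n v j i w * (n j - n v)"
proof -
  have "bcoord m n v i j w * (m i - m v) + bcoord m n v j i w * (m j - m v)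
      = ldet m n v i j * ldet m n v i j * (m w - m v)"
    and "bcoord m n v i j w * (n i - n v) + bcoord m n v j i w * (n j - n v)
      = ldet m n v i j * ldet m n v i j * (n w - n v)"
    unfolding bcoord_def ldet_def by algebra+
  then show "m w - m v = bcoord m n v i j w * (m i - m v) + bcoord m n v j i w * (m j - m v)"
    and "n w - n v = bcoord m n v i j w * (n i - n v) + bcoord m n v j i w * (n j - n v)"
    using ldet_tri_square[OF assms] by simp_all
qed

lemma bcoord_vec:
  assumes "tri v i j"
  shows "b w - b v = real_of_int (bcoord m n v i j w) *\<^sub>R (b i - b v)
    + real_of_int (bcoord m n v j i w) *\<^sub>R (b j - b v)"
proof -
  note bcoord_eq[OF assms, of w, THEN arg_cong[where f = real_of_int], unfolded of_int_add of_int_mult of_int_diff]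
  then show ?thesis by (simp add: lpt_def)
qed

lemma tri_basis_unique:
  assumes "tri v i j"
    and eq: "x *\<^sub>R (b i - b v) + y *\<^sub>R (b j - b v) = x' *\<^sub>R (b i - b v) + y' *\<^sub>R (b j - b v)"
  shows "x = x'" "y = y'"
proof -
  let ?r = real_of_int
  have 1: "(x - x') * (?r (m i) - ?r (m v)) + (y - y') * (?r (m j) - ?r (m v)) = 0"
    and 2: "(x - x') * (?r (n i) - ?r (n v)) + (y - y') * (?r (n j) - ?r (n v)) = 0"
    using eq by (simp_all add: lpt_def algebra_simps)
  let ?D = "(?r (m i) - ?r (m v)) * (?r (n j) - ?r (n v)) - (?r (m j) - ?r (m v)) * (?r (n i) - ?r (n v))"
  have D: "?D = ?r (ldet m n v i j)" by (simp add: ldet_def)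
  then have "?D \<noteq> 0" using ldet_tri[OF assms(1)] by auto
  moreover have "(x - x') * ?D = 0" "(y - y') * ?D = 0" using 1 2 by algebra+
  ultimately show "x = x'" "y = y'" by simp_all
qed

lemma tri_orthogonal_zero:
  assumes t: "tri v i j" and "(b i - b v) \<bullet> \<nu> = 0" "(b j - b v) \<bullet> \<nu> = 0"
  shows "\<nu> = 0"
proof -
  let ?r = real_of_int
  obtain x y where \<nu>: "\<nu> = (x, y)" by fastforce
  have e: "(?r (m i) - ?r (m v)) * x + (?r (n i) - ?r (n v)) * y = 0"
      "(?r (m j) - ?r (m v)) * x + (?r (n j) - ?r (n v)) * y = 0"
    using assms(2,3) by (simp_all add: \<nu> lpt_def)
  let ?D = "(?r (m i) - ?r (m v)) * (?r (n j) - ?r (n v)) - (?r (m j) - ?r (m v)) * (?r (n i) - ?r (n v))"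
  have "?D = ?r (ldet m n v i j)" by (simp add: ldet_def)
  then have "?D \<noteq> 0" using ldet_tri[OF t] by auto
  moreover have "?D * x = 0" "?D * y = 0" using e by algebra+
  ultimately show ?thesis by (simp add: \<nu> zero_prod_def)
qed

lemma in_tri_iff:
  "z \<in> convex hull (b ` {v, i, j}) \<longleftrightarrow>
    (\<exists>x y. x \<ge> 0 \<and> y \<ge> 0 \<and> x + y \<le> 1 \<and> z - b v = x *\<^sub>R (b i - b v) + y *\<^sub>R (b j - b v))"
  by (simp add: convex_hull_3_alt) (auto simp: algebra_simps)

text \<open>By unimodularity the coordinates of a lattice point with respect to the triangle are
  integers, and the only integer points of the standard triangle are its corners.\<close>

lemma vertex_of_tri:
  assumes t: "tri v i j" and w: "w < N" "b w \<in> convex hull (b ` {v, i, j})"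
  shows "w \<in> {v, i, j}"
proof -
  obtain x y where xy: "x \<ge> 0" "y \<ge> 0" "x + y \<le> 1" "b w - b v = x *\<^sub>R (b i - b v) + y *\<^sub>R (b j - b v)"
    using w in_tri_iff by blast
  define x' y' where "x' = bcoord m n v i j w" and "y' = bcoord m n v j i w"
  have x: "x = real_of_int x'" and y: "y = real_of_int y'"
    using tri_basis_unique[OF t, of x y "real_of_int x'" "real_of_int y'"] xy(4) bcoord_vec[OF t, of w]
    by (simp_all add: x'_def y'_def)
  have "x' \<ge> 0" "y' \<ge> 0" "x' + y' \<le> 1" using xy x y by linarith+
  then consider "x' = 0" "y' = 0" | "x' = 1" "y' = 0" | "x' = 0" "y' = 1" by linarith
  then have "b w = b v \<or> b w = b i \<or> b w = b j" using xy(4) x y by cases auto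
  then show ?thesis using b_distinct w(1) tri_less[OF t] by (auto simp: inj_on_def)
qed

lemma polygon_compact: "compact (polygon N m n)" "convex (polygon N m n)"
  unfolding polygon_def by (auto intro: finite_imp_compact_convex_hull)

lemma b_in_polygon: "v < N \<Longrightarrow> b v \<in> polygon N m n"
  unfolding polygon_def by (simp add: hull_inc)

lemma vertex_of_triangle:
  assumes "\<sigma> \<in> T" "w < N" "b w \<in> convex hull (b ` \<sigma>)"
  shows "w \<in> \<sigma>"
proof -
  have "\<sigma> \<noteq> {}" using triangulationD(3) assms(1) by fastforce
  then obtain v where "v \<in> \<sigma>" by blast
  then show ?thesis using assms vertex_of_tri tri_obtain by metis
qed

text \<open>The triangles at \<open>v\<close> cover a neighbourhood of \<open>b v\<close> in the polygon, so they contain an initial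
  part of the segment towards \<open>b w\<close>.\<close>
lemma star_cone:
  assumes v: "v < N" and w: "w < N"
  obtains i j where "tri v i j" "bcoord m n v i j w \<ge> 0" "bcoord m n v j i w \<ge> 0"
proof -
  \<comment> \<open>The triangles away from \<open>v\<close> form a closed set missing
    \<open>b v\<close>, so points close to \<open>b v\<close> lie in triangles at
    \<open>v\<close>.\<close>
  define U where "U = (\<Union>\<sigma>\<in>{\<sigma>\<in>T. v \<notin> \<sigma>}. convex hull (b ` \<sigma>))"
  have fin: "finite \<sigma>" if "\<sigma> \<in> T" for \<sigma>
    using that triangulationD(3) by (metis card.infinite zero_neq_numeral)
  have "closed U"
    unfolding U_def using triangulationD(1) fin by (intro closed_UN) (auto intro!: compact_imp_closed finite_imp_compact_convex_hull)
  moreover have "b v \<notin> U" unfolding U_def using vertex_of_triangle v by blast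
  ultimately obtain e where e: "e > 0" "ball (b v) e \<subseteq> - U"
    by (meson ComplI open_Compl openE)
  \<comment> \<open>Small enough to stay in the ball; adding 1 to the norm avoids division by zero
    when \<open>w = v\<close>.\<close>
  define t where "t = min 1 (e / (2 * (norm (b w - b v) + 1)))"
  have t: "0 < t" "t \<le> 1" using e(1) by (simp_all add: t_def add_nonneg_pos)
  define z where "z = b v + t *\<^sub>R (b w - b v)"
  have "t * norm (b w - b v) \<le> e / (2 * (norm (b w - b v) + 1)) * (norm (b w - b v) + 1)"
    by (intro mult_mono) (use t e(1) in \<open>auto simp: t_def\<close>)
  also have "\<dots> = e / 2" using add_nonneg_pos[OF norm_ge_zero zero_less_one, of "b w - b v"]
    by (simp add: less_imp_neq[symmetric] divide_simps del: norm_minus_commute)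
  finally have "z \<in> ball (b v) e" using t(1) e(1) by (simp add: z_def dist_norm)
  then have "z \<notin> U" using e(2) by blast
  moreover have "z = (1 - t) *\<^sub>R b v + t *\<^sub>R b w" by (simp add: z_def algebra_simps)
  then have "z \<in> polygon N m n"
    using convexD[OF polygon_compact(2) b_in_polygon[OF v] b_in_polygon[OF w], of "1 - t" t] t by simp
  ultimately obtain \<sigma> where \<sigma>: "\<sigma> \<in> T" "v \<in> \<sigma>" "z \<in> convex hull (b ` \<sigma>)"
    using triangulationD(6) unfolding U_def by blast
  then obtain i j where ij: "\<sigma> = {v, i, j}" "tri v i j" using tri_obtain by metis
  then obtain x y where xy: "x \<ge> 0" "y \<ge> 0" "z - b v = x *\<^sub>R (b i - b v) + y *\<^sub>R (b j - b v)"
    using \<sigma>(3) in_tri_iff by blast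
  have "z - b v = (t * bcoord m n v i j w) *\<^sub>R (b i - b v) + (t * bcoord m n v j i w) *\<^sub>R (b j - b v)"
    unfolding z_def using bcoord_vec[OF ij(2), of w] by (simp add: scaleR_add_right)
  then have "x = t * bcoord m n v i j w" "y = t * bcoord m n v j i w"
    using tri_basis_unique[OF ij(2)] xy(3) by metis+
  then have "bcoord m n v i j w \<ge> 0" "bcoord m n v j i w \<ge> 0"
    using xy(1,2) t(1) by (simp_all add: zero_le_mult_iff)
  then show ?thesis using that ij(2) by blast
qed

definition same_class :: "nat \<Rightarrow> nat \<Rightarrow> bool" where
  "same_class v i \<longleftrightarrow> even (m i - m v) \<and> even (n i - n v)"

text \<open>An even edge vector would make the determinant even, but it is 1 or -1. So in the
  quadrant of \<open>v\<close> all neighbours of \<open>v\<close> have the opposite sign.\<close>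

lemma tri_not_same_class: "tri v i j \<Longrightarrow> \<not> same_class v i"
proof
  assume t: "tri v i j" and "same_class v i"
  then have "even (ldet m n v i j)" unfolding ldet_def same_class_def by simp
  then show False using ldet_tri[OF t] by auto
qed

lemma bcoord_bound:
  obtains M :: real where "M \<ge> 1"
    "\<And>v i j w. \<lbrakk>tri v i j; w < N\<rbrakk> \<Longrightarrow> \<bar>real_of_int (bcoord m n v i j w)\<bar> \<le> M"
proof -
  \<comment> \<open>The extra element 1 secures \<open>M \<ge> 1\<close>.\<close>
  let ?S = "insert 1 ((\<lambda>(v, i, j, w). \<bar>real_of_int (bcoord m n v i j w)\<bar>) ` ({..<N} \<times> {..<N} \<times> {..<N} \<times> {..<N}))"
  have fin: "finite ?S" by simp
  show ?thesis
  proof (rule that)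
    show "Max ?S \<ge> 1" using fin by (intro Max_ge) auto
    fix v i j w assume "tri v i j" "w < N"
    then have "(v, i, j, w) \<in> {..<N} \<times> {..<N} \<times> {..<N} \<times> {..<N}" using tri_less by simp
    then have "\<bar>real_of_int (bcoord m n v i j w)\<bar> \<in> ?S" by (intro insertI2 rev_image_eqI[of "(v, i, j, w)"]) auto
    then show "\<bar>real_of_int (bcoord m n v i j w)\<bar> \<le> Max ?S" using fin by (intro Max_ge)
  qed
qed

end

section \<open>The sides of the polygon\<close>

lemma inner_diff_flip: "(x - y) \<bullet> z = z \<bullet> x - z \<bullet> y"
  by (simp add: inner_diff_left inner_commute[of z])

context lattice_triangulation
begin

lemma tri_exists: obtains v i j where "tri v i j"
  using vertex_in_tri[OF N_positive] by blast

lemma aff_dim_tri: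
  assumes t: "tri v i j" and sub: "b ` {v, i, j} \<subseteq> S"
  shows "aff_dim S = 2"
proof -
  have "\<not> aff_dim S < 2"
  proof
    assume "aff_dim S < 2"
    then obtain \<nu> c where \<nu>: "\<nu> \<noteq> 0" "S \<subseteq> {x. \<nu> \<bullet> x = c}"
      using aff_lowdim_subset_hyperplane[of S] by auto
    then have "\<nu> \<bullet> b v = c" "\<nu> \<bullet> b i = c" "\<nu> \<bullet> b j = c" using sub by auto
    then have "(b i - b v) \<bullet> \<nu> = 0" "(b j - b v) \<bullet> \<nu> = 0"
      by (simp_all add: inner_diff_flip)
    then show False using tri_orthogonal_zero[OF t] \<nu>(1) by blast
  qed
  moreover have "aff_dim S \<le> 2" using aff_dim_le_DIM[of S] by simp
  ultimately show ?thesis by simp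
qed

lemma tri_b_distinct: "tri v i j \<Longrightarrow> card (b ` {v, i, j}) = 3"
  using b_distinct tri_less tri_card
  by (metis card_image empty_subsetI inj_on_subset insert_subset lessThan_iff)

lemma tri_affine_independent:
  assumes "tri v i j" shows "\<not> affine_dependent (b ` {v, i, j})"
  using aff_dim_tri[OF assms order_refl] tri_b_distinct[OF assms]
  unfolding affine_independent_iff_card by simp

lemma aff_dim_polygon: "aff_dim (polygon N m n) = 2"
proof -
  obtain v i j where t: "tri v i j" by (rule tri_exists)
  then have "b ` {v, i, j} \<subseteq> polygon N m n" using b_in_polygon tri_less by auto
  then show ?thesis using aff_dim_tri[OF t] by blast
qed

lemma polytope_polygon: "polytope (polygon N m n)"
  unfolding polygon_def polytope_def by blast

text \<open>Faces of polytopes are exposed, so a side is the set where some nonzero linear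
  functional attains its maximum.\<close>

lemma side_normal:
  assumes "is_side (polygon N m n) F"
  obtains \<nu> c where "\<nu> \<noteq> 0" "\<And>z. z \<in> polygon N m n \<Longrightarrow> \<nu> \<bullet> z \<le> c"
    "\<And>z. z \<in> polygon N m n \<Longrightarrow> z \<in> F \<longleftrightarrow> \<nu> \<bullet> z = c"
proof -
  have "F face_of polygon N m n" "aff_dim F = 1" using assms unfolding is_side_def by auto
  then have "F exposed_face_of polygon N m n" "F \<noteq> {}" "F \<noteq> polygon N m n"
    using exposed_face_of_polyhedron[OF polytope_imp_polyhedron[OF polytope_polygon]] aff_dim_polygon
    by auto
  then obtain \<nu> c where \<nu>: "\<nu> \<noteq> 0" "polygon N m n \<subseteq> {x. \<nu> \<bullet> x \<le> c}" "F = polygon N m n \<inter> {x. \<nu> \<bullet> x = c}"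
    unfolding exposed_face_of by blast
  show ?thesis
  proof (rule that[OF \<nu>(1)])
    show "\<nu> \<bullet> z \<le> c" if "z \<in> polygon N m n" for z using \<nu>(2) that by blast
    show "z \<in> F \<longleftrightarrow> \<nu> \<bullet> z = c" if "z \<in> polygon N m n" for z using \<nu>(3) that by blast
  qed
qed

text \<open>The coordinate along \<open>b k - b v\<close> is the lattice distance from the line of
  the side: the normal functional kills the edge \<open>v j\<close> and is strictly negative towards
  \<open>k\<close>.\<close>

lemma side_tri:
  assumes F: "is_side (polygon N m n) F" and t: "tri v j k" and vj: "b v \<in> F" "b j \<in> F"
    and w: "w < N"
  shows "bcoord m n v k j w \<ge> 0" "bcoord m n v k j w = 0 \<longleftrightarrow> b w \<in> F"
proof -
  obtain \<nu> c where \<nu>: "\<nu> \<noteq> 0" "\<And>z. z \<in> polygon N m n \<Longrightarrow> \<nu> \<bullet> z \<le> c"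
    "\<And>z. z \<in> polygon N m n \<Longrightarrow> z \<in> F \<longleftrightarrow> \<nu> \<bullet> z = c" using side_normal[OF F] by blast
  have "(b j - b v) \<bullet> \<nu> = 0"
    using \<nu>(3)[OF b_in_polygon] vj tri_less[OF t] by (simp add: inner_diff_flip)
  then have d: "(b w - b v) \<bullet> \<nu> = bcoord m n v k j w * ((b k - b v) \<bullet> \<nu>)"
    unfolding bcoord_vec[OF t, of w] by (simp add: inner_add_left)
  have "(b k - b v) \<bullet> \<nu> \<noteq> 0" using tri_orthogonal_zero[OF t \<open>(b j - b v) \<bullet> \<nu> = 0\<close>] \<nu>(1) by blast
  moreover have le: "(b i - b v) \<bullet> \<nu> \<le> 0" if "i < N" for i
    using \<nu>(2)[OF b_in_polygon[OF that]] \<nu>(3)[OF b_in_polygon] vj tri_less[OF t]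
    by (simp add: inner_diff_flip)
  ultimately have k: "(b k - b v) \<bullet> \<nu> < 0" using tri_less[OF t] by (metis less_eq_real_def)
  show "bcoord m n v k j w \<ge> 0" using le[OF w] k unfolding d by (simp add: mult_le_0_iff)
  have "b w \<in> F \<longleftrightarrow> (b w - b v) \<bullet> \<nu> = 0"
    using \<nu>(3)[OF b_in_polygon[OF w]] \<nu>(3)[OF b_in_polygon] vj tri_less[OF t]
    by (simp add: inner_diff_flip)
  then show "bcoord m n v k j w = 0 \<longleftrightarrow> b w \<in> F" using k unfolding d by simp
qed

text \<open>The third vertex \<open>k\<close> restricts to edges of the triangulation, excluding
  pairs of distant lattice points of one side.\<close>

definition boundary_edge :: "nat \<Rightarrow> nat \<Rightarrow> bool" where
  "boundary_edge v j \<longleftrightarrow> (\<exists>F. is_side (polygon N m n) F \<and> b v \<in> F \<and> b j \<in> F) \<and> (\<exists>k. tri v j k)"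

text \<open>Triangles meet in the hull of their common vertices. By affine independence, hulls of
  vertex subsets of one triangle intersect in the hull of the common vertices; applying this in each
  triangle puts the meeting point in the hull of the shared endpoints.\<close>

lemma edges_share_vertex:
  assumes t: "tri v j k" "tri v' j' k'"
    and meet: "closed_segment (b v) (b j) \<inter> closed_segment (b v') (b j') \<noteq> {}"
  shows "{v, j} \<inter> {v', j'} \<noteq> {}"
proof -
  let ?s = "{v, j, k}" and ?t = "{v', j', k'}"
  have "?s \<union> ?t \<subseteq> {..<N}" using tri_less[OF t(1)] tri_less[OF t(2)] by auto
  then have inj: "inj_on b (?s \<union> ?t)" by (rule inj_on_subset[OF b_distinct])
  obtain z where z: "z \<in> convex hull (b ` {v, j})" "z \<in> convex hull (b ` {v', j'})"
    using meet by (auto simp: segment_convex_hull)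
  then have "z \<in> convex hull (b ` ?s)" "z \<in> convex hull (b ` ?t)"
    using hull_mono[of "b ` {v, j}" "b ` ?s" convex] hull_mono[of "b ` {v', j'}" "b ` ?t" convex] by auto
  then have st: "z \<in> convex hull (b ` (?s \<inter> ?t))"
    using triangulationD(7)[of ?s ?t] t unfolding tri_def by blast
  have "convex hull (b ` {v, j} \<inter> b ` (?s \<inter> ?t)) = convex hull (b ` {v, j}) \<inter> convex hull (b ` (?s \<inter> ?t))"
    by (rule convex_hull_Int) (rule affine_independent_subset[OF tri_affine_independent[OF t(1)]], blast)
  then have z1: "z \<in> convex hull (b ` {v, j} \<inter> b ` (?s \<inter> ?t))" using z(1) st by blast
  have "convex hull ((b ` {v, j} \<inter> b ` (?s \<inter> ?t)) \<inter> b ` {v', j'})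
      = convex hull (b ` {v, j} \<inter> b ` (?s \<inter> ?t)) \<inter> convex hull (b ` {v', j'})"
    by (rule convex_hull_Int) (rule affine_independent_subset[OF tri_affine_independent[OF t(2)]], blast)
  then have z2: "z \<in> convex hull ((b ` {v, j} \<inter> b ` (?s \<inter> ?t)) \<inter> b ` {v', j'})" using z1 z(2) by blast
  have "b ` {v, j} \<inter> b ` {v', j'} \<noteq> {}"
  proof
    assume "b ` {v, j} \<inter> b ` {v', j'} = {}"
    then have "(b ` {v, j} \<inter> b ` (?s \<inter> ?t)) \<inter> b ` {v', j'} = {}" by blast
    then show False using z2 by simp
  qed
  moreover have "b ` {v, j} \<inter> b ` {v', j'} = b ` ({v, j} \<inter> {v', j'})"
    using inj by (intro inj_on_image_Int[symmetric, OF inj]) auto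
  ultimately show ?thesis by blast
qed

text \<open>A one-dimensional face is a segment whose ends are extreme points of the polygon, hence
  among the points spanning it.\<close>

lemma side_endpoints:
  assumes F: "is_side (polygon N m n) F"
  obtains p q where "p < N" "q < N" "p \<noteq> q" "F = closed_segment (b p) (b q)"
proof -
  have face: "F face_of polygon N m n" and dim: "aff_dim F = 1" using F unfolding is_side_def by auto
  have "F \<noteq> {}" "compact F" "convex F" "collinear F"
    using dim face face_of_imp_convex face_of_imp_compact[OF polygon_compact(2,1)]
    by (auto simp: collinear_aff_dim)
  then obtain A B where AB: "F = closed_segment A B" by (rule compact_convex_collinear_segment)
  have "A \<noteq> B" using dim AB by auto
  have vertex: "x \<in> b ` {..<N}" if "x = A \<or> x = B" for x
  proof -
    have "x extreme_point_of F" unfolding AB extreme_point_of_segment using that .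
    then have "x extreme_point_of polygon N m n" using extreme_point_of_face[OF face] by blast
    then show ?thesis unfolding polygon_def by (rule extreme_point_of_convex_hull)
  qed
  then obtain p q where "p < N" "q < N" "A = b p" "B = b q" by blast
  then show ?thesis using that AB \<open>A \<noteq> B\<close> by blast
qed

text \<open>Dividing the edge vector by the gcd \<open>d\<close> of its coordinates gives a
  primitive step, and the lattice points are its integer multiples from one end.\<close>

lemma side_lattice_points:
  assumes F: "is_side (polygon N m n) F"
  obtains \<iota> :: "nat \<Rightarrow> nat" and d :: nat and e1 e2 :: int where
    "d > 0" "(e1, e2) \<noteq> (0, 0)" "bij_betw \<iota> {..d} (side_indices N m n F)"
    "\<And>l. l \<le> d \<Longrightarrow> m (\<iota> l) = m (\<iota> 0) + int l * e1"
    "\<And>l. l \<le> d \<Longrightarrow> n (\<iota> l) = n (\<iota> 0) + int l * e2"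
    "F = {b (\<iota> 0) + t *\<^sub>R (real_of_int e1, real_of_int e2) | t. 0 \<le> t \<and> t \<le> real d}"
proof -
  obtain p q where pq: "p < N" "q < N" "p \<noteq> q" "F = closed_segment (b p) (b q)"
    by (rule side_endpoints[OF F])
  define g where "g = gcd (m q - m p) (n q - n p)"
  define e1 where "e1 = (m q - m p) div g"
  define e2 where "e2 = (n q - n p) div g"
  define ee where "ee = (real_of_int e1, real_of_int e2)"
  have mn: "m q - m p = g * e1" "n q - n p = g * e2" by (simp_all add: e1_def e2_def g_def)
  have "b p \<noteq> b q" using b_distinct pq by (auto simp: inj_on_def)
  then have "m q - m p \<noteq> 0 \<or> n q - n p \<noteq> 0" by (auto simp: lpt_def)
  then have g: "g > 0" and e0: "(e1, e2) \<noteq> (0, 0)" using mn unfolding g_def by (auto simp: gcd_pos_int)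
  have cop: "coprime e1 e2"
    unfolding e1_def e2_def g_def using g by (intro div_gcd_coprime) (auto simp: g_def)
  define d where "d = nat g"
  have d: "d > 0" "int d = g" using g by (simp_all add: d_def)
  have bq: "b q - b p = real d *\<^sub>R ee"
    using mn[THEN arg_cong[where f = real_of_int]] d(2)[THEN arg_cong[where f = real_of_int]]
    by (simp add: lpt_def ee_def)
  have F_eq: "F = {b p + t *\<^sub>R ee | t. 0 \<le> t \<and> t \<le> real d}"
  proof (intro equalityI subsetI)
    fix x assume "x \<in> F"
    then obtain u where u: "0 \<le> u" "u \<le> 1" "x = (1 - u) *\<^sub>R b p + u *\<^sub>R b q"
      unfolding pq(4) closed_segment_def by blast
    then have "x = b p + u *\<^sub>R (b q - b p)" by (simp add: algebra_simps)
    then have "x = b p + (u * real d) *\<^sub>R ee" unfolding bq by simp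
    moreover have "u * real d \<le> real d" using u by (simp add: mult_left_le_one_le)
    ultimately show "x \<in> {b p + t *\<^sub>R ee | t. 0 \<le> t \<and> t \<le> real d}" using u by fastforce
  next
    fix x assume "x \<in> {b p + t *\<^sub>R ee | t. 0 \<le> t \<and> t \<le> real d}"
    then obtain t where t: "0 \<le> t" "t \<le> real d" "x = b p + t *\<^sub>R ee" by blast
    have "x = b p + (t / real d) *\<^sub>R (b q - b p)" unfolding bq t(3) using d by simp
    then have "x = (1 - t / real d) *\<^sub>R b p + (t / real d) *\<^sub>R b q" by (simp add: algebra_simps)
    then show "x \<in> F" unfolding pq(4) closed_segment_def using t d by fastforce
  qed
  have FP: "F \<subseteq> polygon N m n" using F face_of_imp_subset unfolding is_side_def by blast
  have "\<forall>l\<in>{..d}. \<exists>i. i < N \<and> b i = b p + real l *\<^sub>R ee"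
  proof
    fix l assume "l \<in> {..d}"
    then have "b p + real l *\<^sub>R ee \<in> F" unfolding F_eq by (auto intro!: exI[of _ "real l"])
    moreover have "is_lattice_point (b p + real l *\<^sub>R ee)"
      unfolding is_lattice_point_def by (simp add: lpt_def ee_def)
    ultimately show "\<exists>i. i < N \<and> b i = b p + real l *\<^sub>R ee" using b_lattice FP by (metis subsetD)
  qed
  from bchoice[OF this] obtain \<iota> where \<iota>: "\<And>l. l \<le> d \<Longrightarrow> \<iota> l < N" "\<And>l. l \<le> d \<Longrightarrow> b (\<iota> l) = b p + real l *\<^sub>R ee"
    by auto
  have \<iota>0: "b (\<iota> 0) = b p" using \<iota>(2)[of 0] by simp
  have mn0: "m (\<iota> 0) = m p" "n (\<iota> 0) = n p" using \<iota>0 by (simp_all add: lpt_def)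
  have mnl: "m (\<iota> l) = m p + int l * e1" "n (\<iota> l) = n p + int l * e2" if "l \<le> d" for l
  proof -
    have "real_of_int (m (\<iota> l)) = real_of_int (m p + int l * e1)" "real_of_int (n (\<iota> l)) = real_of_int (n p + int l * e2)"
      using \<iota>(2)[OF that] by (simp_all add: lpt_def ee_def)
    then show "m (\<iota> l) = m p + int l * e1" "n (\<iota> l) = n p + int l * e2" by (simp_all only: of_int_eq_iff)
  qed
  have inj: "inj_on \<iota> {..d}"
  proof (rule inj_onI)
    fix x y assume xy: "x \<in> {..d}" "y \<in> {..d}" "\<iota> x = \<iota> y"
    then have "int x * e1 = int y * e1" "int x * e2 = int y * e2" using mnl[of x] mnl[of y] by auto
    then show "x = y" using e0 by auto
  qed
  have surj: "\<iota> ` {..d} = side_indices N m n F"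
  proof (intro equalityI subsetI)
    fix i assume "i \<in> \<iota> ` {..d}"
    then obtain l where "l \<le> d" "i = \<iota> l" by auto
    then show "i \<in> side_indices N m n F"
      unfolding side_indices_def F_eq using \<iota> by (auto intro!: exI[of _ "real l"])
  next
    fix w assume "w \<in> side_indices N m n F"
    then obtain t where w: "w < N" and t: "0 \<le> t" "t \<le> real d" "b w = b p + t *\<^sub>R ee"
      unfolding side_indices_def F_eq by blast
    \<comment> \<open>A Bezout combination of the coordinates of the primitive vector is 1, so the
      same combination of the coordinates of \<open>b w - b p\<close> recovers \<open>t\<close> as
      an integer.\<close>
    obtain x y where bez: "x * e1 + y * e2 = 1" using bezout_int[of e1 e2] cop by auto
    define k where "k = x * (m w - m p) + y * (n w - n p)"
    have "real_of_int (m w) - real_of_int (m p) = t * real_of_int e1"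
      "real_of_int (n w) - real_of_int (n p) = t * real_of_int e2"
      using t(3) by (simp_all add: lpt_def ee_def)
    then have "real_of_int k = t * (real_of_int x * real_of_int e1 + real_of_int y * real_of_int e2)"
      unfolding k_def by (simp add: algebra_simps)
    also have "\<dots> = t" using bez[THEN arg_cong[where f = real_of_int]] by simp
    finally have k: "real_of_int k = t" .
    then have "k \<ge> 0" "k \<le> int d" using t by linarith+
    then have l: "nat k \<le> d" "real (nat k) = t" using k by (auto simp: nat_le_iff)
    then have "b w = b (\<iota> (nat k))" using \<iota>(2)[OF l(1)] t(3) by simp
    then have "w = \<iota> (nat k)" using b_distinct w \<iota>(1)[OF l(1)] by (auto simp: inj_on_def)
    then show "w \<in> \<iota> ` {..d}" using l(1) by blast
  qed
  show ?thesis
  proof (rule that)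
    show "bij_betw \<iota> {..d} (side_indices N m n F)" using inj surj unfolding bij_betw_def by blast
  qed (use d e0 mnl mn0 F_eq \<iota>0 in \<open>simp_all add: ee_def\<close>)
qed

lemma consecutive_lattice_points:
  assumes F: "is_side (polygon N m n) F" and e0: "(e1, e2) \<noteq> (0, 0)"
    and \<iota>: "bij_betw \<iota> {..d} (side_indices N m n F)"
      "\<And>l. l \<le> d \<Longrightarrow> m (\<iota> l) = m (\<iota> 0) + int l * e1" "\<And>l. l \<le> d \<Longrightarrow> n (\<iota> l) = n (\<iota> 0) + int l * e2"
    and F_eq: "F = {b (\<iota> 0) + t *\<^sub>R (real_of_int e1, real_of_int e2) | t. 0 \<le> t \<and> t \<le> real d}"
    and l: "l < d"
  shows "\<exists>k. tri (\<iota> l) (\<iota> (Suc l)) k"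
proof -
  define ee where "ee = (real_of_int e1, real_of_int e2)"
  have "ee \<noteq> 0" using e0 by (auto simp: ee_def zero_prod_def)
  then have pos: "ee \<bullet> ee > 0" by simp
  have b\<iota>: "b (\<iota> h) = b (\<iota> 0) + real h *\<^sub>R ee" if "h \<le> d" for h
    using \<iota>(2,3)[OF that] by (simp add: lpt_def ee_def)
  \<comment> \<open>A triangle containing the midpoint of two consecutive lattice points of the side has a vertex of
    the side on either side of it; unimodularity forces these to be the two given points.\<close>
  define M where "M = b (\<iota> 0) + (real l + 1/2) *\<^sub>R ee"
  have MF: "M \<in> F" unfolding F_eq M_def ee_def using l by (auto intro!: exI[of _ "real l + 1/2"])
  have face: "F face_of polygon N m n" using F unfolding is_side_def by blast
  then have "M \<in> polygon N m n" using MF face_of_imp_subset by blast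
  then obtain \<sigma> where \<sigma>: "\<sigma> \<in> T" "M \<in> convex hull (b ` \<sigma>)" using triangulationD(6) by blast
  have "convex hull (b ` \<sigma>) \<subseteq> polygon N m n" using \<sigma>(1) triangulationD(6) by blast
  then have "polygon N m n \<inter> convex hull (b ` \<sigma>) = convex hull (b ` \<sigma>)" by blast
  then have "(F \<inter> convex hull (b ` \<sigma>)) face_of (convex hull (b ` \<sigma>))"
    using face_of_slice[OF face convex_convex_hull, of "b ` \<sigma>"] by simp
  moreover have "compact (b ` \<sigma>)"
    using triangulationD(2)[OF \<sigma>(1)] by (intro finite_imp_compact finite_imageI) (rule finite_subset, auto)
  \<comment> \<open>A face of a convex hull is spanned by some of the generators, here by the
    vertices of the triangle that lie on the side.\<close>
  ultimately obtain S' where S': "S' \<subseteq> b ` \<sigma>" "F \<inter> convex hull (b ` \<sigma>) = convex hull S'"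
    using face_of_convex_hull_subset by metis
  then have MS: "M \<in> convex hull S'" and SF: "S' \<subseteq> F" using MF \<sigma>(2) hull_subset[of S' convex] by blast+
  have index: "\<exists>h\<le>d. x = b (\<iota> h) \<and> \<iota> h \<in> \<sigma>" if x: "x \<in> S'" for x
  proof -
    obtain i where i: "i \<in> \<sigma>" "x = b i" using x S'(1) by blast
    then have "i \<in> side_indices N m n F"
      using x SF triangulationD(2)[OF \<sigma>(1)] unfolding side_indices_def by auto
    then obtain h where "h \<le> d" "i = \<iota> h" using \<iota>(1) unfolding bij_betw_def by auto
    then show ?thesis using i by blast
  qed
  have level: "ee \<bullet> b (\<iota> h) = ee \<bullet> b (\<iota> 0) + real h * (ee \<bullet> ee)" if "h \<le> d" for h
    using b\<iota>[OF that] by (simp add: inner_add_right)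
  have levelM: "ee \<bullet> M = ee \<bullet> b (\<iota> 0) + (real l + 1/2) * (ee \<bullet> ee)" by (simp add: M_def inner_add_right)
  have "\<exists>h\<le>l. \<iota> h \<in> \<sigma>"
  proof (rule ccontr)
    assume neg: "\<not> ?thesis"
    have "S' \<subseteq> {x. ee \<bullet> x \<ge> ee \<bullet> b (\<iota> 0) + (real l + 1) * (ee \<bullet> ee)}"
    proof
      fix x assume "x \<in> S'"
      then obtain h where h: "h \<le> d" "x = b (\<iota> h)" "\<iota> h \<in> \<sigma>" using index by blast
      then have "l + 1 \<le> h" using neg by (metis Suc_eq_plus1 not_less_eq_eq)
      then have "real l + 1 \<le> real h" by linarith
      then show "x \<in> {x. ee \<bullet> x \<ge> ee \<bullet> b (\<iota> 0) + (real l + 1) * (ee \<bullet> ee)}"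
        using level[OF h(1)] h(2) pos by (simp add: mult_right_mono)
    qed
    then have "convex hull S' \<subseteq> {x. ee \<bullet> x \<ge> ee \<bullet> b (\<iota> 0) + (real l + 1) * (ee \<bullet> ee)}"
      by (rule hull_minimal) (rule convex_halfspace_ge)
    then have "ee \<bullet> M \<ge> ee \<bullet> b (\<iota> 0) + (real l + 1) * (ee \<bullet> ee)" using MS by blast
    then show False using levelM pos by (simp add: algebra_simps)
  qed
  then obtain x where x: "x \<le> l" "\<iota> x \<in> \<sigma>" by blast
  have "\<exists>h>l. h \<le> d \<and> \<iota> h \<in> \<sigma>"
  proof (rule ccontr)
    assume neg: "\<not> ?thesis"
    have "S' \<subseteq> {x. ee \<bullet> x \<le> ee \<bullet> b (\<iota> 0) + real l * (ee \<bullet> ee)}"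
    proof
      fix x assume "x \<in> S'"
      then obtain h where h: "h \<le> d" "x = b (\<iota> h)" "\<iota> h \<in> \<sigma>" using index by blast
      then have "h \<le> l" using neg by (metis not_less)
      then show "x \<in> {x. ee \<bullet> x \<le> ee \<bullet> b (\<iota> 0) + real l * (ee \<bullet> ee)}"
        using level[OF h(1)] h(2) pos by (simp add: mult_right_mono)
    qed
    then have "convex hull S' \<subseteq> {x. ee \<bullet> x \<le> ee \<bullet> b (\<iota> 0) + real l * (ee \<bullet> ee)}"
      by (rule hull_minimal) (rule convex_halfspace_le)
    then have "ee \<bullet> M \<le> ee \<bullet> b (\<iota> 0) + real l * (ee \<bullet> ee)" using MS by blast
    then show False using levelM pos by (simp add: algebra_simps)
  qed
  then obtain y where y: "l < y" "y \<le> d" "\<iota> y \<in> \<sigma>" by blast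
  have xd: "x \<le> d" using x y by simp
  have "\<iota> x \<noteq> \<iota> y" using bij_betw_imp_inj_on[OF \<iota>(1)] xd x y(1,2)
    by (metis atMost_iff inj_on_contraD leD)
  obtain i j where ij: "\<sigma> = {\<iota> x, i, j}" "tri (\<iota> x) i j" using tri_obtain[OF \<sigma>(1) x(2)] .
  have "\<iota> y = i \<or> \<iota> y = j" using y(3) \<open>\<iota> x \<noteq> \<iota> y\<close> ij(1) by auto
  then obtain k where t: "tri (\<iota> x) (\<iota> y) k"
    using ij(2) tri_swap(1)[OF ij(2)] by auto
  \<comment> \<open>The edge vector is the primitive step times the index difference, which
    therefore divides the determinant.\<close>
  have "ldet m n (\<iota> x) (\<iota> y) k
      = (int y - int x) * (e1 * (n k - n (\<iota> x)) - (m k - m (\<iota> x)) * e2)"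
    unfolding ldet_def using \<iota>(2,3)[OF xd] \<iota>(2,3)[OF y(2)] by (simp add: algebra_simps)
  then have "(int y - int x) dvd ldet m n (\<iota> x) (\<iota> y) k" by simp
  then have "(int y - int x) dvd 1" using ldet_tri[OF t] by auto
  then have "int y - int x = 1" using x y by auto
  then have "y = Suc l" "x = l" using x y by linarith+
  then show ?thesis using t by blast
qed

lemma side_progression:
  assumes F: "is_side (polygon N m n) F"
  obtains \<iota> :: "nat \<Rightarrow> nat" and d :: nat and e1 e2 :: int where
    "d > 0" "bij_betw \<iota> {..d} (side_indices N m n F)"
    "\<And>l. l \<le> d \<Longrightarrow> m (\<iota> l) = m (\<iota> 0) + int l * e1"
    "\<And>l. l \<le> d \<Longrightarrow> n (\<iota> l) = n (\<iota> 0) + int l * e2"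
    "\<And>l. l < d \<Longrightarrow> \<exists>k. tri (\<iota> l) (\<iota> (Suc l)) k"
    "F = (\<Union>l<d. closed_segment (b (\<iota> l)) (b (\<iota> (Suc l))))"
proof -
  obtain \<iota> :: "nat \<Rightarrow> nat" and d :: nat and e1 e2 :: int where
    D: "d > 0" "(e1, e2) \<noteq> (0, 0)" and \<iota>: "bij_betw \<iota> {..d} (side_indices N m n F)"
    "\<And>l. l \<le> d \<Longrightarrow> m (\<iota> l) = m (\<iota> 0) + int l * e1"
    "\<And>l. l \<le> d \<Longrightarrow> n (\<iota> l) = n (\<iota> 0) + int l * e2"
    and F_eq: "F = {b (\<iota> 0) + t *\<^sub>R (real_of_int e1, real_of_int e2) | t. 0 \<le> t \<and> t \<le> real d}"
    by (rule side_lattice_points[OF F], rule that)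
  define ee where "ee = (real_of_int e1, real_of_int e2)"
  have b\<iota>: "b (\<iota> h) = b (\<iota> 0) + real h *\<^sub>R ee" if "h \<le> d" for h
    using \<iota>(2,3)[OF that] by (simp add: lpt_def ee_def)
  have "F = (\<Union>l<d. closed_segment (b (\<iota> l)) (b (\<iota> (Suc l))))"
  proof (intro equalityI subsetI)
    fix x assume "x \<in> F"
    then obtain t where t: "0 \<le> t" "t \<le> real d" "x = b (\<iota> 0) + t *\<^sub>R ee" unfolding F_eq ee_def by blast
    \<comment> \<open>The cap \<open>d - 1\<close> treats the far end \<open>t = d\<close>, which
      belongs to the last segment.\<close>
    define l where "l = min (nat \<lfloor>t\<rfloor>) (d - 1)"
    have l: "l < d" "real l \<le> t" "t \<le> real l + 1"
      using t D(1) unfolding l_def by linarith+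
    have "x = (1 - (t - real l)) *\<^sub>R b (\<iota> l) + (t - real l) *\<^sub>R b (\<iota> (Suc l))"
      using b\<iota>[of l] b\<iota>[of "Suc l"] l(1) t(3) by (simp add: algebra_simps)
    then have "x \<in> closed_segment (b (\<iota> l)) (b (\<iota> (Suc l)))"
      unfolding closed_segment_def using l by (intro CollectI exI[of _ "t - real l"]) auto
    then show "x \<in> (\<Union>l<d. closed_segment (b (\<iota> l)) (b (\<iota> (Suc l))))" using l(1) by blast
  next
    fix x assume "x \<in> (\<Union>l<d. closed_segment (b (\<iota> l)) (b (\<iota> (Suc l))))"
    then obtain l where l: "l < d" "x \<in> closed_segment (b (\<iota> l)) (b (\<iota> (Suc l)))" by blast
    have "\<iota> l \<in> side_indices N m n F" "\<iota> (Suc l) \<in> side_indices N m n F"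
      using \<iota>(1) l(1) unfolding bij_betw_def by auto
    then have "b (\<iota> l) \<in> F" "b (\<iota> (Suc l)) \<in> F" unfolding side_indices_def by auto
    then have "closed_segment (b (\<iota> l)) (b (\<iota> (Suc l))) \<subseteq> F"
      using F face_of_imp_convex unfolding is_side_def by (meson closed_segment_subset)
    then show "x \<in> F" using l(2) by blast
  qed
  then show ?thesis using that[OF D(1) \<iota>] consecutive_lattice_points[OF F D(2) \<iota> F_eq] by blast
qed

text \<open>The boundary of the polygon is connected, and unit edges that meet share a vertex.\<close>
lemma boundary_edge_induct:
  assumes start: "boundary_edge v0 j0" "Q v0 j0"
    and step: "\<And>v j v' j'. \<lbrakk>boundary_edge v j; boundary_edge v' j'; {v, j} \<inter> {v', j'} \<noteq> {}; Q v j\<rbrakk> \<Longrightarrow> Q v' j'"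
    and edge: "boundary_edge v j"
  shows "Q v j"
proof -
  define seg where "seg A = (\<Union>(v, j)\<in>A. closed_segment (b v) (b j))" for A
  define B where "B = {(v, j). boundary_edge v j}"
  have "B \<subseteq> {..<N} \<times> {..<N}" unfolding B_def boundary_edge_def using tri_less by blast
  then have fin: "finite B" by (rule finite_subset) simp
  have closed: "closed (seg A)" if "A \<subseteq> B" for A
    unfolding seg_def using finite_subset[OF that fin] by (intro closed_UN) auto
  \<comment> \<open>The edges with and without \<open>Q\<close> would split the connected boundary
    into two disjoint closed sets.\<close>
  let ?A = "{(v, j)\<in>B. Q v j}" and ?C = "{(v, j)\<in>B. \<not> Q v j}"
  have "rel_frontier (polygon N m n) = seg B"
  proof -
    have "rel_frontier (polygon N m n) = \<Union>{F. is_side (polygon N m n) F}"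
      unfolding rel_frontier_of_polyhedron[OF polytope_imp_polyhedron[OF polytope_polygon]]
      by (rule arg_cong[where f = Union]) (auto simp: facet_of_def is_side_def aff_dim_polygon)
    also have "\<dots> = seg B"
    proof (intro equalityI subsetI)
      fix x assume "x \<in> \<Union>{F. is_side (polygon N m n) F}"
      then obtain F where F: "is_side (polygon N m n) F" "x \<in> F" by blast
      obtain \<iota> :: "nat \<Rightarrow> nat" and d :: nat where \<iota>: "bij_betw \<iota> {..d} (side_indices N m n F)"
        "\<And>l. l < d \<Longrightarrow> \<exists>k. tri (\<iota> l) (\<iota> (Suc l)) k"
        "F = (\<Union>l<d. closed_segment (b (\<iota> l)) (b (\<iota> (Suc l))))"
        by (rule side_progression[OF F(1)], rule that)
      obtain l where l: "l < d" "x \<in> closed_segment (b (\<iota> l)) (b (\<iota> (Suc l)))" using F(2) \<iota>(3) by blast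
      have "\<iota> l \<in> side_indices N m n F" "\<iota> (Suc l) \<in> side_indices N m n F"
        using \<iota>(1) l(1) unfolding bij_betw_def by auto
      then have "(\<iota> l, \<iota> (Suc l)) \<in> B"
        using F(1) \<iota>(2)[OF l(1)] unfolding B_def boundary_edge_def side_indices_def by blast
      then show "x \<in> seg B" using l(2) unfolding seg_def by blast
    next
      fix x assume "x \<in> seg B"
      then obtain v j F where F: "is_side (polygon N m n) F" "b v \<in> F" "b j \<in> F" "x \<in> closed_segment (b v) (b j)"
        unfolding seg_def B_def boundary_edge_def by blast
      then have "x \<in> F" using face_of_imp_convex closed_segment_subset unfolding is_side_def by blast
      then show "x \<in> \<Union>{F. is_side (polygon N m n) F}" using F(1) by blast
    qed
    finally show ?thesis .
  qed
  moreover have "connected (rel_frontier (polygon N m n))"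
    using polygon_compact aff_dim_polygon by (intro connected_sphere_gen) (auto simp: compact_imp_bounded)
  ultimately have "connected (seg B)" by simp
  moreover have "seg B = seg ?A \<union> seg ?C" unfolding seg_def by blast
  moreover have "seg ?A \<inter> seg ?C = {}"
  proof (rule ccontr)
    assume "seg ?A \<inter> seg ?C \<noteq> {}"
    then obtain v j v' j' where *: "boundary_edge v j" "Q v j" "boundary_edge v' j'" "\<not> Q v' j'"
      "closed_segment (b v) (b j) \<inter> closed_segment (b v') (b j') \<noteq> {}"
      unfolding seg_def B_def by blast
    then have "{v, j} \<inter> {v', j'} \<noteq> {}" unfolding boundary_edge_def using edges_share_vertex by blast
    then show False using step * by blast
  qed
  moreover have "closed (seg ?A)" "closed (seg ?C)" by (rule closed; blast)+
  moreover have "seg ?A \<noteq> {}" using start unfolding seg_def B_def by auto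
  ultimately have "seg ?C = {}" unfolding connected_closed by blast
  then show ?thesis using edge unfolding seg_def B_def by auto
qed

end

section \<open>Connectedness of zero sets\<close>

text \<open>The zero set is the image of the convex set \<open>{f < 0}\<close> under sliding along \<open>-\<nu>\<close> until
  \<open>f\<close> vanishes.\<close>
lemma connected_zero_level:
  fixes f g :: "'a::real_normed_vector \<Rightarrow> real"
  assumes f: "continuous_on UNIV f" and g: "continuous_on UNIV g"
    and conv: "convex {u. f u < 0 \<and> g u \<le> c}"
    and mono_g: "\<And>u t. t \<ge> 0 \<Longrightarrow> g (u + t *\<^sub>R \<nu>) \<le> g u"
    and decr_f: "\<And>u t. \<lbrakk>t > 0; g u \<le> c\<rbrakk> \<Longrightarrow> f (u + t *\<^sub>R \<nu>) < f u"
    and reach: "\<And>u. \<exists>t>0. g (u - t *\<^sub>R \<nu>) \<ge> c"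
    and pos: "\<And>u. g u = c \<Longrightarrow> f u > 0"
  shows "connected {u. f u = 0 \<and> g u \<le> c}"
proof -
  let ?D = "{u. f u < 0 \<and> g u \<le> c}"
  have decr: "f (u - s *\<^sub>R \<nu>) < f (u - t *\<^sub>R \<nu>)" if "s < t" "g (u - t *\<^sub>R \<nu>) \<le> c" for u s t
    using decr_f[of "t - s" "u - t *\<^sub>R \<nu>"] that by (simp add: algebra_simps)
  have mono: "g (u - s *\<^sub>R \<nu>) \<le> g (u - t *\<^sub>R \<nu>)" if "s \<le> t" for u s t
    using mono_g[of "t - s" "u - t *\<^sub>R \<nu>"] that by (simp add: algebra_simps)
  have contf: "continuous_on A (\<lambda>t. f (u - t *\<^sub>R \<nu>))" and contg: "continuous_on A (\<lambda>t. g (u - t *\<^sub>R \<nu>))" for A u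
    by (intro continuous_on_compose2[OF f] continuous_on_compose2[OF g] continuous_intros; simp)+
  have "\<forall>u\<in>?D. \<exists>t. t > 0 \<and> f (u - t *\<^sub>R \<nu>) = 0 \<and> g (u - t *\<^sub>R \<nu>) \<le> c"
  proof
    fix u assume u: "u \<in> ?D"
    \<comment> \<open>Sliding back from \<open>u\<close> reaches the level \<open>g = c\<close>,
      where \<open>f\<close> is positive, so \<open>f\<close> vanishes on the way while
      \<open>g \<le> c\<close> still holds.\<close>
    obtain t1 where "t1 > 0" "g (u - t1 *\<^sub>R \<nu>) \<ge> c" using reach by blast
    then obtain t2 where t2: "0 \<le> t2" "g (u - t2 *\<^sub>R \<nu>) = c"
      using IVT'[of "\<lambda>t. g (u - t *\<^sub>R \<nu>)" 0 c t1] u contg by auto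
    have "f (u - t2 *\<^sub>R \<nu>) > 0" using pos t2 by blast
    then obtain t where t: "0 \<le> t" "t \<le> t2" "f (u - t *\<^sub>R \<nu>) = 0"
      using IVT'[of "\<lambda>t. f (u - t *\<^sub>R \<nu>)" 0 0 t2] u contf t2 by auto
    have "t \<noteq> 0" using t(3) u by auto
    with t mono[OF t(2), of u] t2(2) show "\<exists>t. t > 0 \<and> f (u - t *\<^sub>R \<nu>) = 0 \<and> g (u - t *\<^sub>R \<nu>) \<le> c"
      by (intro exI[of _ t]) auto
  qed
  from bchoice[OF this] obtain \<tau> where \<tau>: "\<And>u. u \<in> ?D \<Longrightarrow> \<tau> u > 0" "\<And>u. u \<in> ?D \<Longrightarrow> f (u - \<tau> u *\<^sub>R \<nu>) = 0"
      "\<And>u. u \<in> ?D \<Longrightarrow> g (u - \<tau> u *\<^sub>R \<nu>) \<le> c"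
    by blast
  \<comment> \<open>These comparisons bound \<open>\<tau>\<close> by sign conditions on
    \<open>f\<close> and \<open>g\<close> at a fixed shift. The conditions persist for nearby
    \<open>u\<close>, which gives continuity without an inverse function theorem.\<close>
  have below: "a < \<tau> u" if "u \<in> ?D" "f (u - a *\<^sub>R \<nu>) < 0" "g (u - a *\<^sub>R \<nu>) \<le> c" for a u
    using decr[of "\<tau> u" a u] \<tau>(2)[OF that(1)] that by (cases "\<tau> u" a rule: linorder_cases) auto
  have above: "\<tau> u < a" if "u \<in> ?D" "f (u - a *\<^sub>R \<nu>) > 0" for a u
    using decr[of a "\<tau> u" u] \<tau>(2,3)[OF that(1)] that(2) by (cases "\<tau> u" a rule: linorder_cases) auto
  have above': "\<tau> u < a" if "u \<in> ?D" "g (u - a *\<^sub>R \<nu>) > c" for a u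
    using mono[of a "\<tau> u" u] \<tau>(3)[OF that(1)] that(2) by (cases "\<tau> u < a") auto
  have "continuous_on ?D \<tau>"
    unfolding continuous_on_def
  proof (intro ballI order_tendstoI)
    fix u a assume u: "u \<in> ?D"
    have shift: "((\<lambda>x. h (x - a *\<^sub>R \<nu>)) \<longlongrightarrow> h (u - a *\<^sub>R \<nu>)) (at u within ?D)"
      if "continuous_on UNIV h" for h :: "'a \<Rightarrow> real"
    proof -
      have "continuous_on UNIV (\<lambda>x. h (x - a *\<^sub>R \<nu>))"
        by (intro continuous_on_compose2[OF that] continuous_intros) auto
      then show ?thesis unfolding continuous_on_def
        using tendsto_within_subset[OF _ subset_UNIV, of "\<lambda>x. h (x - a *\<^sub>R \<nu>)" _ u] by blast
    qed
    note evf = shift[OF f] and evg = shift[OF g]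
    have inD: "\<forall>\<^sub>F x in at u within ?D. x \<in> ?D" by (simp add: eventually_at_filter)
    show "\<forall>\<^sub>F x in at u within ?D. a < \<tau> x" if a: "a < \<tau> u"
    proof -
      have le: "g (u - a *\<^sub>R \<nu>) \<le> c" using mono[of a "\<tau> u" u] \<tau>(3)[OF u] a by simp
      have neg: "f (u - a *\<^sub>R \<nu>) < 0" using decr[OF a \<tau>(3)[OF u]] \<tau>(2)[OF u] by simp
      \<comment> \<open>Equality is impossible because \<open>f\<close> is positive on the level
        \<open>c\<close>; the strict inequality is stable under small changes of
        \<open>u\<close>.\<close>
      have "g (u - a *\<^sub>R \<nu>) < c" using le neg pos[of "u - a *\<^sub>R \<nu>"] by fastforce
      then have "\<forall>\<^sub>F x in at u within ?D. g (x - a *\<^sub>R \<nu>) < c" using evg by (simp add: order_tendstoD)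
      moreover have "\<forall>\<^sub>F x in at u within ?D. f (x - a *\<^sub>R \<nu>) < 0"
        using evf neg by (simp add: order_tendstoD)
      ultimately show ?thesis using inD by eventually_elim (blast intro: below less_imp_le)
    qed
    show "\<forall>\<^sub>F x in at u within ?D. \<tau> x < a" if a: "\<tau> u < a"
    proof (cases "g (u - a *\<^sub>R \<nu>) \<le> c")
      case True
      then have "f (u - a *\<^sub>R \<nu>) > 0" using decr[OF a, of u] \<tau>(2)[OF u] by simp
      then have "\<forall>\<^sub>F x in at u within ?D. f (x - a *\<^sub>R \<nu>) > 0" using evf by (simp add: order_tendstoD)
      then show ?thesis using inD by eventually_elim (blast intro: above)
    next
      case False
      then have "\<forall>\<^sub>F x in at u within ?D. g (x - a *\<^sub>R \<nu>) > c" using evg by (simp add: order_tendstoD)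
      then show ?thesis using inD by eventually_elim (blast intro: above')
    qed
  qed
  then have "connected ((\<lambda>u. u - \<tau> u *\<^sub>R \<nu>) ` ?D)"
    by (intro connected_continuous_image convex_connected[OF conv] continuous_intros)
  moreover have "(\<lambda>u. u - \<tau> u *\<^sub>R \<nu>) ` ?D = {u. f u = 0 \<and> g u \<le> c}"
  proof (intro equalityI subsetI)
    fix x assume "x \<in> (\<lambda>u. u - \<tau> u *\<^sub>R \<nu>) ` ?D"
    then show "x \<in> {u. f u = 0 \<and> g u \<le> c}" using \<tau> by auto
  next
    fix x assume x: "x \<in> {u. f u = 0 \<and> g u \<le> c}"
    \<comment> \<open>Every zero is reached: a unit step forward enters the negative region, and
      strict decrease forces \<open>\<tau> u = 1\<close>.\<close>
    define u where "u = x + 1 *\<^sub>R \<nu>"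
    have u: "u \<in> ?D" using decr_f[of 1 x] mono_g[of 1 x] x by (auto simp: u_def)
    have "\<not> \<tau> u < 1" using decr[of "\<tau> u" 1 u] \<tau>(2)[OF u] x by (auto simp: u_def)
    moreover have "\<not> 1 < \<tau> u" using decr[of 1 "\<tau> u" u] \<tau>(2,3)[OF u] x by (auto simp: u_def)
    ultimately have "\<tau> u = 1" by simp
    then have "x = u - \<tau> u *\<^sub>R \<nu>" by (simp add: u_def)
    then show "x \<in> (\<lambda>u. u - \<tau> u *\<^sub>R \<nu>) ` ?D" using u by blast
  qed
  ultimately show ?thesis by simp
qed

section \<open>The sign patterns of the curve in a quadrant\<close>

text \<open>\<open>a\<close> are the coefficients of the curve and \<open>M\<close> bounds all barycentric coordinates of lattice
  points. The size of \<open>\<eta>\<close> makes the monomials of minority sign negligible on \<open>S v \<le> 3\<close>.\<close>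
locale harnack_curve = lattice_triangulation +
  fixes a :: "nat \<Rightarrow> real" and \<eta> M :: real
  assumes sign_neg: "\<And>i. \<lbrakk>i < N; odd (m i); odd (n i)\<rbrakk> \<Longrightarrow> a i < 0"
    and sign_pos: "\<And>i. \<lbrakk>i < N; even (m i) \<or> even (n i)\<rbrakk> \<Longrightarrow> a i > 0"
    and M: "M \<ge> 1"
      "\<And>v i j w. \<lbrakk>tri v i j; w < N\<rbrakk> \<Longrightarrow> \<bar>real_of_int (bcoord m n v i j w)\<bar> \<le> M"
    and \<eta>: "\<eta> > 0" "8 * real N * M\<^sup>2 * (\<eta> * 3 powr (2 * M)) \<le> 1"
    and dominated: "\<And>v i j w. \<lbrakk>tri v i j; w < N; w \<notin> {v, i, j}\<rbrakk> \<Longrightarrow>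
      ln \<bar>a w\<bar> - ln \<bar>a v\<bar> \<le> ln \<eta> + bcoord m n v i j w * (ln \<bar>a i\<bar> - ln \<bar>a v\<bar>)
        + bcoord m n v j i w * (ln \<bar>a j\<bar> - ln \<bar>a v\<bar>)"
begin

text \<open>\<open>exp (E i u)\<close> is the absolute value of the \<open>i\<close>-th monomial at \<open>(\<plusminus>exp (fst u), \<plusminus>exp (snd u))\<close>, and
  \<open>X v i u\<close> its ratio to the \<open>v\<close>-th one. In the quadrant attached to \<open>v\<close> below, the monomials with the
  sign of the \<open>v\<close>-th one are those whose exponents are congruent to \<open>b v\<close> modulo 2, so that there the curve
  is \<open>\<Phi> v = 0\<close>.\<close>
definition E :: "nat \<Rightarrow> real \<times> real \<Rightarrow> real" where
  "E i u = ln \<bar>a i\<bar> + b i \<bullet> u"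

definition X :: "nat \<Rightarrow> nat \<Rightarrow> real \<times> real \<Rightarrow> real" where
  "X v i u = exp (E i u - E v u)"

text \<open>The monomials of sign opposite to the \<open>v\<close>-th one in its quadrant; they
  enter \<open>\<Phi> v\<close> with a plus sign.\<close>

definition pos :: "nat \<Rightarrow> nat set" where
  "pos v = {i. i < N \<and> \<not> same_class v i}"

definition minority :: "nat \<Rightarrow> nat set" where
  "minority v = {i. i < N \<and> same_class v i \<and> i \<noteq> v}"

definition S :: "nat \<Rightarrow> real \<times> real \<Rightarrow> real" where
  "S v u = (\<Sum>i\<in>pos v. X v i u)"

definition \<Phi> :: "nat \<Rightarrow> real \<times> real \<Rightarrow> real" where
  "\<Phi> v u = S v u - 1 - (\<Sum>w\<in>minority v. X v w u)"

lemma finite_pos [simp]: "finite (pos v)" and finite_minority [simp]: "finite (minority v)"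
  unfolding pos_def minority_def by simp_all

lemma X_pos [simp]: "X v i u > 0" and X_nonneg [simp]: "X v i u \<ge> 0"
  unfolding X_def by simp_all

lemma tri_pos: "tri v i j \<Longrightarrow> i \<in> pos v" "tri v i j \<Longrightarrow> j \<in> pos v"
  unfolding pos_def using tri_less tri_not_same_class tri_swap(1) by blast+

lemma E_dominated:
  assumes "tri v i j" "w < N" "w \<notin> {v, i, j}"
  shows "E w u - E v u \<le> ln \<eta> + bcoord m n v i j w * (E i u - E v u) + bcoord m n v j i w * (E j u - E v u)"
proof -
  have "b w \<bullet> u - b v \<bullet> u = (b w - b v) \<bullet> u" by (simp add: inner_diff_left)
  also have "\<dots> = bcoord m n v i j w * (b i \<bullet> u - b v \<bullet> u) + bcoord m n v j i w * (b j \<bullet> u - b v \<bullet> u)"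
    by (simp add: bcoord_vec[OF assms(1), of w] inner_add_left inner_diff_left)
  finally show ?thesis using dominated[OF assms] unfolding E_def by (simp add: algebra_simps)
qed

lemma X_le_3:
  assumes "S v u \<le> 3" "i \<in> pos v" shows "X v i u \<le> 3"
  using assms member_le_sum[of i "pos v" "\<lambda>i. X v i u"] unfolding S_def by fastforce

text \<open>Domination bounds the ratio by \<open>\<eta>\<close> times a monomial in
  \<open>X v i u\<close> and \<open>X v j u\<close>. One factor \<open>X v i u\<close> is kept; the
  remaining exponents sum to at most \<open>2 * M\<close>, and each base is at most 3.\<close>

lemma X_minority_le:
  assumes t: "tri v i j" and w: "w \<in> minority v" and S: "S v u \<le> 3"
    and nonneg: "bcoord m n v i j w \<ge> 0" "bcoord m n v j i w \<ge> 0" and ge: "bcoord m n v i j w \<ge> 1"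
  shows "X v w u \<le> \<eta> * 3 powr (2 * M) * X v i u"
proof -
  define al be where "al = real_of_int (bcoord m n v i j w)" and "be = real_of_int (bcoord m n v j i w)"
  have w': "w < N" "w \<notin> {v, i, j}" using w tri_pos[OF t] unfolding minority_def pos_def by auto
  have bounds: "al \<ge> 1" "be \<ge> 0" "al \<le> M" "be \<le> M"
    using nonneg ge M(2)[OF t w'(1)] M(2)[OF tri_swap(1)[OF t] w'(1)] by (auto simp: al_def be_def)
  define x y where "x = E i u - E v u" and "y = E j u - E v u"
  have "exp x \<le> 3" "exp y \<le> 3" using X_le_3[OF S] tri_pos[OF t] unfolding X_def x_def y_def by simp_all
  then have xy: "x \<le> ln 3" "y \<le> ln 3" by (simp_all add: ln_ge_iff)
  have "E w u - E v u \<le> ln \<eta> + al * x + be * y"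
    using E_dominated[OF t w'] unfolding al_def be_def x_def y_def .
  also have "\<dots> = ln \<eta> + (al - 1) * x + be * y + x" by (simp add: algebra_simps)
  also have "\<dots> \<le> ln \<eta> + (al - 1) * ln 3 + be * ln 3 + x"
    using bounds xy by (intro add_mono mult_left_mono) auto
  also have "\<dots> = ln \<eta> + (al - 1 + be) * ln 3 + x" by (simp add: algebra_simps)
  also have "\<dots> \<le> ln \<eta> + (2 * M) * ln 3 + x"
    using bounds by (intro add_mono mult_right_mono) auto
  finally have "exp (E w u - E v u) \<le> exp (ln \<eta> + (2 * M) * ln 3 + x)" by simp
  also have "\<dots> = \<eta> * 3 powr (2 * M) * exp x" using \<eta>(1) by (simp add: exp_add powr_def)
  finally show ?thesis unfolding X_def x_def .
qed

lemma card_minority: "card (minority v) \<le> N"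
  using card_mono[of "{..<N}" "minority v"] unfolding minority_def by force

text \<open>On \<open>S v \<le> 3\<close> a minority monomial \<open>w\<close> is controlled by the two vertices of the triangle at \<open>v\<close>
  whose cone contains \<open>b w\<close>. The weights \<open>\<omega>\<close> needed are those of the value and of the first
  two directional derivatives.\<close>
lemma minority_weight:
  fixes \<omega> :: "nat \<Rightarrow> real"
  assumes v: "v < N" and S: "S v u \<le> 3" and \<omega>: "\<And>i. i \<in> pos v \<Longrightarrow> \<omega> i \<ge> 0"
    and conv: "\<And>i j w. \<lbrakk>tri v i j; w \<in> minority v; bcoord m n v i j w \<ge> 0; bcoord m n v j i w \<ge> 0\<rbrakk> \<Longrightarrow>
      \<omega> w \<le> 2 * ((real_of_int (bcoord m n v i j w))\<^sup>2 * \<omega> i + (real_of_int (bcoord m n v j i w))\<^sup>2 * \<omega> j)"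
  shows "(\<Sum>w\<in>minority v. X v w u * \<omega> w) \<le> 1/4 * (\<Sum>i\<in>pos v. X v i u * \<omega> i)"
proof -
  let ?k = "\<eta> * 3 powr (2 * M)" and ?R = "\<Sum>i\<in>pos v. X v i u * \<omega> i"
  have k: "?k > 0" using \<eta>(1) by simp
  have R: "?R \<ge> 0" using \<omega> by (intro sum_nonneg mult_nonneg_nonneg) auto
  \<comment> \<open>A zero coordinate makes the left side vanish; a positive integer coordinate is
    at least 1, as \<open>X_minority_le\<close> requires.\<close>
  have term_le: "X v w u * ((real_of_int (bcoord m n v i j w))\<^sup>2 * \<omega> i) \<le> M\<^sup>2 * ?k * (X v i u * \<omega> i)"
    if t: "tri v i j" and w: "w \<in> minority v"
      and nonneg: "bcoord m n v i j w \<ge> 0" "bcoord m n v j i w \<ge> 0" for i j w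
  proof (cases "bcoord m n v i j w = 0")
    case True
    then show ?thesis using \<omega>[OF tri_pos(1)[OF t]] k by (simp add: mult_nonneg_nonneg)
  next
    case False
    have "w < N" using w unfolding minority_def by simp
    then have "(real_of_int (bcoord m n v i j w))\<^sup>2 \<le> M\<^sup>2"
      using M(2)[OF t] by (metis abs_ge_zero power2_abs power_mono)
    moreover have "X v w u \<le> ?k * X v i u" using X_minority_le[OF t w S nonneg] False nonneg by simp
    ultimately have "X v w u * (real_of_int (bcoord m n v i j w))\<^sup>2 \<le> ?k * X v i u * M\<^sup>2"
      using k by (intro mult_mono) auto
    then have "X v w u * (real_of_int (bcoord m n v i j w))\<^sup>2 * \<omega> i \<le> ?k * X v i u * M\<^sup>2 * \<omega> i"
      using \<omega>[OF tri_pos(1)[OF t]] by (rule mult_right_mono)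
    then show ?thesis by (simp add: mult_ac)
  qed
  have "X v w u * \<omega> w \<le> 2 * M\<^sup>2 * ?k * ?R" if w: "w \<in> minority v" for w
  proof -
    have "w < N" using w unfolding minority_def by simp
    then obtain i j where t: "tri v i j" and nonneg: "bcoord m n v i j w \<ge> 0" "bcoord m n v j i w \<ge> 0"
      using star_cone[OF v] by blast
    have "i \<noteq> j" using t unfolding tri_def by simp
    have "X v w u * \<omega> w \<le> X v w u * (2 * ((real_of_int (bcoord m n v i j w))\<^sup>2 * \<omega> i + (real_of_int (bcoord m n v j i w))\<^sup>2 * \<omega> j))"
      using conv[OF t w nonneg] by (rule mult_left_mono) simp
    also have "\<dots> = 2 * (X v w u * ((real_of_int (bcoord m n v i j w))\<^sup>2 * \<omega> i) + X v w u * ((real_of_int (bcoord m n v j i w))\<^sup>2 * \<omega> j))"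
      by (simp add: algebra_simps)
    also have "\<dots> \<le> 2 * (M\<^sup>2 * ?k * (X v i u * \<omega> i) + M\<^sup>2 * ?k * (X v j u * \<omega> j))"
      using term_le[OF t w nonneg] term_le[OF tri_swap(1)[OF t] w nonneg(2,1)]
      by (intro mult_left_mono add_mono) auto
    also have "\<dots> = 2 * M\<^sup>2 * ?k * (\<Sum>l\<in>{i, j}. X v l u * \<omega> l)" using \<open>i \<noteq> j\<close> by (simp add: algebra_simps)
    also have "\<dots> \<le> 2 * M\<^sup>2 * ?k * ?R"
      using k tri_pos[OF t] \<omega> by (intro mult_left_mono sum_mono2) auto
    finally show ?thesis .
  qed
  then have "(\<Sum>w\<in>minority v. X v w u * \<omega> w) \<le> real (card (minority v)) * (2 * M\<^sup>2 * ?k * ?R)"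
    by (rule sum_bounded_above)
  also have "\<dots> \<le> real N * (2 * M\<^sup>2 * ?k * ?R)"
    using card_minority k R by (intro mult_right_mono) auto
  \<comment> \<open>The factor 8 in the smallness condition is \<open>2 * 4\<close>: 2 from the
    hypothesis on the weights, 4 from the fraction claimed.\<close>
  also have "\<dots> = 1/4 * (8 * real N * M\<^sup>2 * ?k) * ?R" by simp
  also have "\<dots> \<le> 1/4 * 1 * ?R" by (intro mult_right_mono mult_left_mono \<eta>(2) R) auto
  finally show ?thesis by simp
qed

lemma bcoord_square_ge: "real_of_int (bcoord m n v i j w) \<le> (real_of_int (bcoord m n v i j w))\<^sup>2"
proof -
  have "bcoord m n v i j w \<le> (bcoord m n v i j w)\<^sup>2"
    by (smt (verit) mult_le_cancel_left1 power2_eq_square zero_le_square)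
  then show ?thesis by (metis of_int_le_iff of_int_power)
qed

text \<open>Weights 1 are admissible because a point \<open>b w\<close> other than
  \<open>b v\<close> has nonnegative integer coordinates, not both zero. On \<open>S v u = 3\<close>
  it yields \<open>\<Phi> v u > 0\<close>.\<close>

lemma minority_sum_le:
  assumes v: "v < N" and S: "S v u \<le> 3"
  shows "(\<Sum>w\<in>minority v. X v w u) \<le> 1/4 * S v u"
proof -
  have "(\<Sum>w\<in>minority v. X v w u * 1) \<le> 1/4 * (\<Sum>i\<in>pos v. X v i u * 1)"
  proof (rule minority_weight[OF v S])
    fix i j w assume t: "tri v i j" and w: "w \<in> minority v"
      and nonneg: "bcoord m n v i j w \<ge> 0" "bcoord m n v j i w \<ge> 0"
    have "bcoord m n v i j w + bcoord m n v j i w \<noteq> 0"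
    proof
      assume "bcoord m n v i j w + bcoord m n v j i w = 0"
      then have "bcoord m n v i j w = 0" "bcoord m n v j i w = 0" using nonneg by linarith+
      then have "b w - b v = 0" using bcoord_vec[OF t, of w] by simp
      then show False using b_distinct w v unfolding minority_def inj_on_def by auto
    qed
    then have "bcoord m n v i j w + bcoord m n v j i w \<ge> 1" using nonneg by linarith
    then have "real_of_int (bcoord m n v i j w) + real_of_int (bcoord m n v j i w) \<ge> 1" by linarith
    then have "(real_of_int (bcoord m n v i j w))\<^sup>2 + (real_of_int (bcoord m n v j i w))\<^sup>2 \<ge> 1"
      using add_mono[OF bcoord_square_ge[of v i j w] bcoord_square_ge[of v j i w]] by (rule order_trans)
    then show "1 \<le> 2 * ((real_of_int (bcoord m n v i j w))\<^sup>2 * 1 + (real_of_int (bcoord m n v j i w))\<^sup>2 * 1)"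
      by simp
  qed simp
  then show ?thesis by (simp add: S_def)
qed

section \<open>Derivatives along lines and monotonicity along outward normals\<close>

lemma X_line_derivative:
  "((\<lambda>t. X v i (u + t *\<^sub>R d)) has_real_derivative X v i (u + t *\<^sub>R d) * ((b i - b v) \<bullet> d)) (at t)"
  unfolding X_def E_def
  by (auto intro!: derivative_eq_intros simp: inner_add_right inner_diff_left algebra_simps)

lemma X_continuous: "continuous_on A (X v i)"
  unfolding X_def E_def by (intro continuous_intros)

lemma S_continuous: "continuous_on A (S v)" and \<Phi>_continuous: "continuous_on A (\<Phi> v)"
  unfolding \<Phi>_def S_def by (intro continuous_intros X_continuous)+

lemma X_shift: "X v i (u + t *\<^sub>R d) = X v i u * exp (t * ((b i - b v) \<bullet> d))"
  unfolding X_def E_def by (simp add: inner_add_right inner_diff_left algebra_simps flip: exp_add)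

text \<open>The nonzero outward normals of the polygon at \<open>b v\<close>; they exist at boundary
  points.\<close>

definition supports :: "nat \<Rightarrow> real \<times> real \<Rightarrow> bool" where
  "supports v \<nu> \<longleftrightarrow> \<nu> \<noteq> 0 \<and> (\<forall>i<N. (b i - b v) \<bullet> \<nu> \<le> 0)"

text \<open>The two edges of a triangle at \<open>v\<close> span the plane, so a nonzero normal
  cannot be orthogonal to both.\<close>

lemma supports_strict:
  assumes v: "v < N" and \<nu>: "supports v \<nu>"
  obtains i where "i \<in> pos v" "(b i - b v) \<bullet> \<nu> < 0"
proof -
  obtain i j where t: "tri v i j" using vertex_in_tri[OF v] by blast
  have "(b i - b v) \<bullet> \<nu> \<le> 0" "(b j - b v) \<bullet> \<nu> \<le> 0"
    using \<nu> tri_less[OF t] unfolding supports_def by blast+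
  moreover have "\<not> ((b i - b v) \<bullet> \<nu> = 0 \<and> (b j - b v) \<bullet> \<nu> = 0)"
    using tri_orthogonal_zero[OF t] \<nu> unfolding supports_def by blast
  ultimately show ?thesis using that tri_pos[OF t] by (metis less_eq_real_def)
qed

lemma S_antimono:
  assumes "supports v \<nu>" "t \<ge> 0"
  shows "S v (u + t *\<^sub>R \<nu>) \<le> S v u"
  unfolding S_def X_shift
proof (rule sum_mono)
  fix i assume "i \<in> pos v"
  then have "t * ((b i - b v) \<bullet> \<nu>) \<le> 0"
    using assms unfolding supports_def pos_def by (auto simp: mult_nonneg_nonpos)
  then show "X v i u * exp (t * ((b i - b v) \<bullet> \<nu>)) \<le> X v i u" by (simp add: mult_left_le)
qed

text \<open>With weights \<open>- ((b i - b v) \<bullet> \<nu>)\<close>, the minority terms offset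
  at most a quarter of the decrease of \<open>S v\<close>, which is strict. The bound
  \<open>S v \<le> 3\<close> persists along \<open>\<nu>\<close>.\<close>

lemma \<Phi>_decreasing:
  assumes v: "v < N" and \<nu>: "supports v \<nu>" and t: "t > 0" and S: "S v u \<le> 3"
  shows "\<Phi> v (u + t *\<^sub>R \<nu>) < \<Phi> v u"
proof -
  let ?d = "\<lambda>i. (b i - b v) \<bullet> \<nu>"
  let ?D = "\<lambda>s. (\<Sum>i\<in>pos v. X v i (u + s *\<^sub>R \<nu>) * ?d i) - (\<Sum>w\<in>minority v. X v w (u + s *\<^sub>R \<nu>) * ?d w)"
  have "\<Phi> v (u + t *\<^sub>R \<nu>) < \<Phi> v (u + 0 *\<^sub>R \<nu>)"
  proof (rule DERIV_neg_imp_decreasing[OF t])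
    fix s assume s: "0 \<le> s" "s \<le> t"
    let ?u = "u + s *\<^sub>R \<nu>"
    have S': "S v ?u \<le> 3" using S_antimono[OF \<nu> s(1), of u] S by linarith
    have "((\<lambda>s. \<Phi> v (u + s *\<^sub>R \<nu>)) has_real_derivative ?D s) (at s)"
      unfolding \<Phi>_def S_def by (auto intro!: derivative_eq_intros X_line_derivative)
    moreover have "?D s < 0"
    proof -
      have "(\<Sum>w\<in>minority v. X v w ?u * - ?d w) \<le> 1/4 * (\<Sum>i\<in>pos v. X v i ?u * - ?d i)"
      proof (rule minority_weight[OF v S'])
        show "0 \<le> - ?d i" if "i \<in> pos v" for i using that \<nu> unfolding supports_def pos_def by auto
      next
        fix i j w assume t: "tri v i j"
        define al be where "al = real_of_int (bcoord m n v i j w)" and "be = real_of_int (bcoord m n v j i w)"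
        have d: "- ?d i \<ge> 0" "- ?d j \<ge> 0" using \<nu> tri_less[OF t] unfolding supports_def by auto
        have "- ?d w = al * - ?d i + be * - ?d j"
          unfolding al_def be_def bcoord_vec[OF t, of w] inner_add_left by simp
        also have "\<dots> \<le> al\<^sup>2 * - ?d i + be\<^sup>2 * - ?d j"
          unfolding al_def be_def using bcoord_square_ge d by (intro add_mono mult_right_mono) auto
        also have "\<dots> \<le> 2 * (al\<^sup>2 * - ?d i + be\<^sup>2 * - ?d j)"
        proof -
          have "0 \<le> al\<^sup>2 * - ?d i" "0 \<le> be\<^sup>2 * - ?d j" using d by (metis mult_nonneg_nonneg zero_le_power2)+
          then have "0 \<le> al\<^sup>2 * - ?d i + be\<^sup>2 * - ?d j" by (rule add_nonneg_nonneg)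
          moreover have "z \<le> 2 * z" if "0 \<le> z" for z :: real using that by simp
          ultimately show ?thesis by blast
        qed
        finally show "- ?d w \<le> 2 * ((real_of_int (bcoord m n v i j w))\<^sup>2 * - ?d i
            + (real_of_int (bcoord m n v j i w))\<^sup>2 * - ?d j)"
          unfolding al_def be_def .
      qed
      moreover have "(\<Sum>i\<in>pos v. X v i ?u * - ?d i) > 0"
      proof -
        obtain i where "i \<in> pos v" "?d i < 0" using supports_strict[OF v \<nu>] by blast
        moreover have "0 \<le> X v i ?u * - ?d i" if "i \<in> pos v" for i
          using that \<nu> unfolding supports_def pos_def by (auto intro!: mult_nonneg_nonpos)
        ultimately show ?thesis by (intro sum_pos2[of _ i]) (auto intro: mult_pos_neg)
      qed
      ultimately show ?thesis by (simp add: sum_negf)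
    qed
    ultimately show "\<exists>y. ((\<lambda>s. \<Phi> v (u + s *\<^sub>R \<nu>)) has_real_derivative y) (at s) \<and> y < 0" by blast
  qed
  then show ?thesis by simp
qed

section \<open>Convexity along segments and connectedness of the branch\<close>

lemma S_convex_line: "convex_on UNIV (\<lambda>t. S v (u + t *\<^sub>R d))"
  unfolding S_def
proof (rule f''_ge0_imp_convex[where f' = "\<lambda>t. \<Sum>i\<in>pos v. X v i (u + t *\<^sub>R d) * ((b i - b v) \<bullet> d)"
      and f'' = "\<lambda>t. \<Sum>i\<in>pos v. X v i (u + t *\<^sub>R d) * ((b i - b v) \<bullet> d) * ((b i - b v) \<bullet> d)"])
  show "0 \<le> (\<Sum>i\<in>pos v. X v i (u + t *\<^sub>R d) * ((b i - b v) \<bullet> d) * ((b i - b v) \<bullet> d))" for t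
    by (intro sum_nonneg) (simp add: mult.assoc)
qed (auto intro!: derivative_eq_intros X_line_derivative)

lemma S_sublevel_segment:
  assumes "S v u \<le> 3" "S v (u + d) \<le> 3" "0 \<le> t" "t \<le> 1"
  shows "S v (u + t *\<^sub>R d) \<le> 3"
  using convex_onD[OF S_convex_line, of t 0 1 v u d] assms
    convex_bound_le[of "S v u" 3 "S v (u + d)" "1 - t" t] by simp

text \<open>The second derivative is nonnegative, by \<open>minority_weight\<close> with the squared
  directional increments. The inequality for the square of a sum is what calls for the factor 2
  there.\<close>

lemma \<Phi>_convex_segment:
  fixes d :: "real \<times> real"
  assumes v: "v < N" and S: "S v u \<le> 3" "S v (u + d) \<le> 3"
  shows "convex_on {0..1} (\<lambda>t. \<Phi> v (u + t *\<^sub>R d))"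
proof -
  let ?e = "\<lambda>i. (b i - b v) \<bullet> d" and ?u = "\<lambda>t. u + t *\<^sub>R d"
  let ?f1 = "\<lambda>t. (\<Sum>i\<in>pos v. X v i (?u t) * ?e i) - (\<Sum>w\<in>minority v. X v w (?u t) * ?e w)"
  let ?f2 = "\<lambda>t. (\<Sum>i\<in>pos v. X v i (?u t) * ?e i * ?e i) - (\<Sum>w\<in>minority v. X v w (?u t) * ?e w * ?e w)"
  have 1: "((\<lambda>t. \<Phi> v (?u t)) has_real_derivative ?f1 t) (at t)" for t
    unfolding \<Phi>_def S_def by (auto intro!: derivative_eq_intros X_line_derivative)
  have 2: "(?f1 has_real_derivative ?f2 t) (at t)" for t
    by (auto intro!: derivative_eq_intros X_line_derivative)
  have 3: "?f2 t \<ge> 0" if t: "t \<in> {0..1}" for t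
  proof -
    have S': "S v (?u t) \<le> 3" using S_sublevel_segment[OF S] t by simp
    have "(\<Sum>w\<in>minority v. X v w (?u t) * (?e w)\<^sup>2) \<le> 1/4 * (\<Sum>i\<in>pos v. X v i (?u t) * (?e i)\<^sup>2)"
    proof (rule minority_weight[OF v S'])
      fix i j w assume t: "tri v i j"
      define p q where "p = real_of_int (bcoord m n v i j w) * ?e i"
        and "q = real_of_int (bcoord m n v j i w) * ?e j"
      have "(?e w)\<^sup>2 = (p + q)\<^sup>2"
        unfolding p_def q_def bcoord_vec[OF t, of w] inner_add_left by simp
      also have "\<dots> \<le> 2 * (p\<^sup>2 + q\<^sup>2)"
        using zero_le_power2[of "p - q"] by (simp add: power2_eq_square algebra_simps)
      finally show "(?e w)\<^sup>2 \<le> 2 * ((real_of_int (bcoord m n v i j w))\<^sup>2 * (?e i)\<^sup>2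
          + (real_of_int (bcoord m n v j i w))\<^sup>2 * (?e j)\<^sup>2)"
        by (simp add: p_def q_def power_mult_distrib)
    qed simp
    moreover have "(\<Sum>i\<in>pos v. X v i (?u t) * (?e i)\<^sup>2) \<ge> 0"
      by (intro sum_nonneg) simp
    ultimately show ?thesis by (simp add: power2_eq_square mult.assoc)
  qed
  show ?thesis by (rule f''_ge0_imp_convex[OF _ 1 2 3]) simp_all
qed

lemma \<Phi>_negative_convex:
  assumes v: "v < N"
  shows "convex {u. \<Phi> v u < 0 \<and> S v u \<le> 3}"
  unfolding convex_alt
proof (intro ballI allI impI)
  fix x y and t :: real
  assume x: "x \<in> {u. \<Phi> v u < 0 \<and> S v u \<le> 3}" and y: "y \<in> {u. \<Phi> v u < 0 \<and> S v u \<le> 3}"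
    and t: "0 \<le> t \<and> t \<le> 1"
  define d where "d = y - x"
  have eq: "(1 - t) *\<^sub>R x + t *\<^sub>R y = x + t *\<^sub>R d" and y': "y = x + d" by (simp_all add: d_def algebra_simps)
  have "S v (x + t *\<^sub>R d) \<le> 3" using S_sublevel_segment[of v x d t] x y t y' by auto
  moreover have "\<Phi> v (x + t *\<^sub>R d) < 0"
  proof -
    have "convex_on {0..1} (\<lambda>t. \<Phi> v (x + t *\<^sub>R d))" using \<Phi>_convex_segment[OF v, of x d] x y y' by auto
    then have "\<Phi> v (x + ((1 - t) *\<^sub>R 0 + t *\<^sub>R 1) *\<^sub>R d) \<le> (1 - t) * \<Phi> v (x + 0 *\<^sub>R d) + t * \<Phi> v (x + 1 *\<^sub>R d)"
      using t by (intro convex_onD) auto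
    also have "\<dots> = (1 - t) * \<Phi> v x + t * \<Phi> v y" using y' by simp
    also have "\<dots> < 0" using convex_bound_lt[of "\<Phi> v x" 0 "\<Phi> v y" "1 - t" t] x y t by simp
    finally show ?thesis by simp
  qed
  ultimately show "(1 - t) *\<^sub>R x + t *\<^sub>R y \<in> {u. \<Phi> v u < 0 \<and> S v u \<le> 3}" using eq by simp
qed

lemma S_unbounded:
  assumes v: "v < N" and \<nu>: "supports v \<nu>"
  shows "\<exists>t>0. S v (u - t *\<^sub>R \<nu>) \<ge> 3"
proof -
  obtain i where i: "i \<in> pos v" "(b i - b v) \<bullet> \<nu> < 0" using supports_strict[OF v \<nu>] by blast
  define c where "c = - ((b i - b v) \<bullet> \<nu>)"
  \<comment> \<open>Solves \<open>X v i u * (t * c) = 3\<close>; the exponential exceeds its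
    argument, so the \<open>i\<close>-th ratio alone reaches 3.\<close>
  define t where "t = 3 / (c * X v i u)"
  have c: "c > 0" using i by (simp add: c_def)
  have t: "t > 0" using c by (simp add: t_def)
  have "3 = X v i u * (t * c)" using c X_pos[of v i u] by (simp add: t_def less_imp_neq[symmetric])
  also have "\<dots> \<le> X v i u * exp (t * c)"
  proof (rule mult_left_mono)
    show "t * c \<le> exp (t * c)" using exp_ge_add_one_self[of "t * c"] by linarith
  qed simp
  also have "\<dots> = X v i (u - t *\<^sub>R \<nu>)" using X_shift[of v i u "- t" \<nu>] by (simp add: c_def)
  also have "\<dots> \<le> S v (u - t *\<^sub>R \<nu>)" unfolding S_def using i(1) by (intro member_le_sum) auto
  finally show ?thesis using t by blast
qed

text \<open>The bound on \<open>S v\<close> keeps to the region where the minority monomials are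
  under control.\<close>

definition branch :: "nat \<Rightarrow> (real \<times> real) set" where
  "branch v = {u. \<Phi> v u = 0 \<and> S v u \<le> 3}"

lemma branch_connected:
  assumes v: "v < N" and \<nu>: "supports v \<nu>"
  shows "connected (branch v)"
  unfolding branch_def
proof (rule connected_zero_level[OF \<Phi>_continuous S_continuous \<Phi>_negative_convex[OF v]])
  show "S v (u + t *\<^sub>R \<nu>) \<le> S v u" if "t \<ge> 0" for u t by (rule S_antimono[OF \<nu> that])
  show "\<Phi> v (u + t *\<^sub>R \<nu>) < \<Phi> v u" if "t > 0" "S v u \<le> 3" for u t by (rule \<Phi>_decreasing[OF v \<nu> that])
  show "\<exists>t>0. S v (u - t *\<^sub>R \<nu>) \<ge> 3" for u by (rule S_unbounded[OF v \<nu>])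
  show "\<Phi> v u > 0" if "S v u = 3" for u
    using minority_sum_le[OF v, of u] that unfolding \<Phi>_def by simp
qed

end

section \<open>Arcs of the curve and their end points on the axes\<close>

context harnack_curve
begin

text \<open>The signs \<open>(-1) ^ (n v + 1)\<close>, \<open>(-1) ^ (m v + 1)\<close> of the coordinates in the quadrant of \<open>v\<close>: the
  sign \<open>(-1) ^ (m i * n i)\<close> of \<open>a i\<close> turns into a constant times
  \<open>(-1) ^ ((m i + m v + 1) * (n i + n v + 1))\<close>, whose exponent is odd exactly for \<open>i\<close> in the class of \<open>v\<close>.\<close>
definition sgx :: "nat \<Rightarrow> real" where "sgx v = (if even (n v) then - 1 else 1)"
definition sgy :: "nat \<Rightarrow> real" where "sgy v = (if even (m v) then - 1 else 1)"

definition msign :: "nat \<Rightarrow> nat \<Rightarrow> real" where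
  "msign v i = sgx v powi m i * sgy v powi n i"

definition point :: "nat \<Rightarrow> real \<times> real \<Rightarrow> (nat \<Rightarrow> real) set" where
  "point v u = line_of (monomial_map N m n (sgx v * exp (fst u)) (sgy v * exp (snd u)))"

definition curve :: "(nat \<Rightarrow> real) set set" where
  "curve = proj_space N closure_of {line_of (monomial_map N m n x y) | x y.
     x \<noteq> 0 \<and> y \<noteq> 0 \<and> (\<Sum>i<N. a i * x powi m i * y powi n i) = 0}"

definition arc :: "nat \<Rightarrow> (nat \<Rightarrow> real) set set" where
  "arc v = proj_space N closure_of (point v ` branch v)"

text \<open>Compares the monomials of the curve polynomial, coefficients included. The comparison is
  invariant under scaling, so it labels a projective point by an edge.\<close>

definition dominant_on :: "nat set \<Rightarrow> (nat \<Rightarrow> real) set \<Rightarrow> bool" where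
  "dominant_on e z \<longleftrightarrow> (\<forall>V\<in>z. \<forall>i\<in>e. \<forall>w<N. w \<notin> e \<longrightarrow> \<bar>a w * V w\<bar> < \<bar>a i * V i\<bar>)"

lemma a_nonzero: "i < N \<Longrightarrow> a i \<noteq> 0"
  using sign_neg sign_pos by (metis less_irrefl)

lemma msign_eq: "msign v i = (if even (m i) then 1 else sgx v) * (if even (n i) then 1 else sgy v)"
  unfolding msign_def sgx_def sgy_def by (auto simp: power_int_minus_left)

lemma msign_nonzero [simp]: "msign v i \<noteq> 0" "\<bar>msign v i\<bar> = 1"
  unfolding msign_eq sgx_def sgy_def by auto

lemma sign_pattern:
  assumes "i < N" "v < N"
  shows "sgn (a i) * msign v i = (if same_class v i then 1 else - 1) * (sgn (a v) * msign v v)"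
proof -
  have "sgn (a i) = (if odd (m i) \<and> odd (n i) then - 1 else 1)" if "i < N" for i
    using sign_neg[OF that] sign_pos[OF that] by auto
  then show ?thesis
    using assms unfolding msign_eq sgx_def sgy_def same_class_def by auto
qed

lemma monomial_eq:
  assumes "i < N"
  shows "monomial_map N m n (sgx v * exp (fst u)) (sgy v * exp (snd u)) i
    = msign v i / \<bar>a i\<bar> * exp (E i u)"
proof -
  have "exp (E i u) = \<bar>a i\<bar> * exp (b i \<bullet> u)"
    using a_nonzero[OF assms] by (simp add: E_def exp_add)
  also have "b i \<bullet> u = m i * fst u + n i * snd u" by (simp add: lpt_def inner_prod_def)
  finally have "exp (E i u) = \<bar>a i\<bar> * (exp (fst u) powi m i * exp (snd u) powi n i)"
    by (simp add: exp_add exp_power_int)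
  then show ?thesis
    using assms a_nonzero[OF assms]
    by (simp add: monomial_map_def msign_def power_int_mult_distrib)
qed

text \<open>The sign pattern lets the signed \<open>v\<close>-th monomial be factored out, so zeros
  of \<open>\<Phi> v\<close> are points of the curve in the quadrant of \<open>v\<close>.\<close>

lemma curve_polynomial:
  assumes v: "v < N"
  shows "(\<Sum>i<N. a i * (sgx v * exp (fst u)) powi m i * (sgy v * exp (snd u)) powi n i)
    = - (sgn (a v) * msign v v) * exp (E v u) * \<Phi> v u"
proof -
  let ?s = "sgn (a v) * msign v v"
  have "(\<Sum>i<N. a i * (sgx v * exp (fst u)) powi m i * (sgy v * exp (snd u)) powi n i)
      = (\<Sum>i<N. ?s * exp (E v u) * ((if same_class v i then 1 else - 1) * X v i u))"
  proof (rule sum.cong)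
    fix i assume "i \<in> {..<N}"
    then have i: "i < N" by simp
    have "a i * (sgx v * exp (fst u)) powi m i * (sgy v * exp (snd u)) powi n i
        = a i * monomial_map N m n (sgx v * exp (fst u)) (sgy v * exp (snd u)) i"
      using i by (simp add: monomial_map_def)
    also have "\<dots> = (sgn (a i) * msign v i) * exp (E i u)"
      using a_nonzero[OF i] by (simp add: monomial_eq[OF i] sgn_real_def)
    also have "\<dots> = ?s * exp (E v u) * ((if same_class v i then 1 else - 1) * X v i u)"
      unfolding sign_pattern[OF i v] X_def by (simp add: exp_diff)
    finally show "a i * (sgx v * exp (fst u)) powi m i * (sgy v * exp (snd u)) powi n i
        = ?s * exp (E v u) * ((if same_class v i then 1 else - 1) * X v i u)" .
  qed simp
  also have "\<dots> = ?s * exp (E v u) * (\<Sum>i<N. (if same_class v i then 1 else - 1) * X v i u)"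
    by (simp add: sum_distrib_left)
  also have "(\<Sum>i<N. (if same_class v i then 1 else - 1) * X v i u) = - \<Phi> v u"
  proof -
    have split: "{..<N} = pos v \<union> insert v (minority v)" "pos v \<inter> insert v (minority v) = {}" "v \<notin> minority v"
      using v unfolding pos_def minority_def same_class_def by auto
    have "(\<Sum>i<N. (if same_class v i then 1 else - 1) * X v i u)
        = (\<Sum>i\<in>pos v. (if same_class v i then 1 else - 1) * X v i u)
        + (\<Sum>i\<in>insert v (minority v). (if same_class v i then 1 else - 1) * X v i u)"
      unfolding split(1) using split(2) by (intro sum.union_disjoint) auto
    also have "(\<Sum>i\<in>pos v. (if same_class v i then 1 else - 1) * X v i u) = - S v u"
      unfolding S_def pos_def by (simp add: sum_negf)
    also have "(\<Sum>i\<in>insert v (minority v). (if same_class v i then 1 else - 1) * X v i u)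
        = (\<Sum>i\<in>insert v (minority v). X v i u)"
      by (intro sum.cong) (auto simp: minority_def same_class_def)
    also have "\<dots> = 1 + (\<Sum>i\<in>minority v. X v i u)" using split(3) by (simp add: X_def)
    finally show ?thesis unfolding \<Phi>_def by simp
  qed
  finally show ?thesis by simp
qed

lemma monomial_map_point:
  assumes "x \<noteq> 0" "y \<noteq> 0" "N > 0"
  shows "monomial_map N m n x y \<in> topspace (Euclidean_space N)" "monomial_map N m n x y \<noteq> (\<lambda>i. 0)"
proof -
  show "monomial_map N m n x y \<in> topspace (Euclidean_space N)"
    by (simp add: monomial_map_def topspace_Euclidean_space)
  have "monomial_map N m n x y 0 \<noteq> 0" using assms by (simp add: monomial_map_def)
  then show "monomial_map N m n x y \<noteq> (\<lambda>i. 0)" by metis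
qed

lemma quadrant_nonzero: "sgx v * exp t \<noteq> 0" "sgy v * exp t \<noteq> 0"
  by (simp_all add: sgx_def sgy_def)

lemma arc_connected:
  assumes v: "v < N" and "supports v \<nu>"
  shows "connectedin (proj_space N) (arc v)"
proof -
  have "continuous_map euclidean (proj_space N) (point v)"
    unfolding point_def
  proof (rule continuous_map_line_of)
    show "continuous_on UNIV (\<lambda>u. monomial_map N m n (sgx v * exp (fst u)) (sgy v * exp (snd u)) i)" for i
      unfolding monomial_map_def
      by (cases "i < N") (auto intro!: continuous_intros simp: sgx_def sgy_def)
  qed (use v monomial_map_point[OF quadrant_nonzero] in auto)
  moreover have "connectedin euclidean (branch v)"
    using branch_connected[OF assms] by simp
  ultimately show ?thesis
    unfolding arc_def by (intro connectedin_closure_of connectedin_continuous_map_image)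
qed

lemma arc_subset_curve:
  assumes "v < N" shows "arc v \<subseteq> curve"
  unfolding arc_def curve_def
proof (intro closure_of_mono subsetI)
  fix z assume "z \<in> point v ` branch v"
  then obtain u where u: "z = point v u" "\<Phi> v u = 0" unfolding branch_def by auto
  then show "z \<in> {line_of (monomial_map N m n x y) | x y.
     x \<noteq> 0 \<and> y \<noteq> 0 \<and> (\<Sum>i<N. a i * x powi m i * y powi n i) = 0}"
    unfolding point_def mem_Collect_eq
    using quadrant_nonzero curve_polynomial[OF assms, of u]
    by (intro exI[of _ "sgx v * exp (fst u)"] exI[of _ "sgy v * exp (snd u)"]) simp
qed

lemma curve_subset_toric_surface: "curve \<subseteq> real_toric_surface N m n"
  unfolding curve_def real_toric_surface_def by (rule closure_of_mono) blast

section \<open>Limit points of the branches on the axes\<close>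

lemma tri_dual_basis:
  assumes t: "tri v i j"
  obtains \<alpha> \<beta> where "(b i - b v) \<bullet> \<alpha> = 1" "(b j - b v) \<bullet> \<alpha> = 0" "(b i - b v) \<bullet> \<beta> = 0" "(b j - b v) \<bullet> \<beta> = 1"
proof -
  let ?r = real_of_int
  define D where "D = ?r (ldet m n v i j)"
  have D: "D * D = 1" using ldet_tri_square[OF t] unfolding D_def by (metis of_int_1 of_int_mult)
  have D': "D = (?r (m i) - ?r (m v)) * (?r (n j) - ?r (n v)) - (?r (m j) - ?r (m v)) * (?r (n i) - ?r (n v))"
    unfolding D_def ldet_def by simp
  show ?thesis
  proof (rule that)
    \<comment> \<open>The columns of the inverse matrix; as \<open>D * D = 1\<close>, multiplying by
      \<open>D\<close> replaces dividing by it.\<close>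
    let ?\<alpha> = "(D * (?r (n j) - ?r (n v)), - D * (?r (m j) - ?r (m v)))"
    let ?\<beta> = "(- D * (?r (n i) - ?r (n v)), D * (?r (m i) - ?r (m v)))"
    let ?det = "(?r (m i) - ?r (m v)) * (?r (n j) - ?r (n v)) - (?r (m j) - ?r (m v)) * (?r (n i) - ?r (n v))"
    have "(b i - b v) \<bullet> ?\<alpha> = D * ?det" "(b j - b v) \<bullet> ?\<beta> = D * ?det"
      by (simp_all add: lpt_def algebra_simps)
    then have "(b i - b v) \<bullet> ?\<alpha> = D * D" "(b j - b v) \<bullet> ?\<beta> = D * D"
      by (simp_all only: D'[symmetric])
    then show "(b i - b v) \<bullet> ?\<alpha> = 1" "(b j - b v) \<bullet> ?\<beta> = 1" using D by simp_all
    show "(b j - b v) \<bullet> ?\<alpha> = 0" "(b i - b v) \<bullet> ?\<beta> = 0" by (simp_all add: lpt_def algebra_simps)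
  qed
qed

lemma bcoord_vertex:
  assumes "tri v j k"
  shows "bcoord m n v j k v = 0" "bcoord m n v j k j = 1" "bcoord m n v j k k = 0"
  using ldet_tri_square[OF assms] unfolding bcoord_def by (simp_all add: ldet_def)

text \<open>Coordinates \<open>s\<close>, \<open>K\<close> of the plane in which \<open>X v j = exp s\<close> and \<open>X v k = exp (-K)\<close>; the
  axis of a side through \<open>b v\<close>, \<open>b j\<close> is approached for \<open>K\<close> tending to infinity.\<close>
lemma tri_coordinates:
  assumes t: "tri v j k"
  obtains U :: "real \<Rightarrow> real \<Rightarrow> real \<times> real" and c :: "nat \<Rightarrow> real"
  where "\<And>K. continuous_on UNIV (\<lambda>s. U s K)"
    "\<And>w (s::real) (K::real). X v w (U s K) = exp (c w + bcoord m n v j k w * s - bcoord m n v k j w * K)"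
    "c v = 0" "c j = 0" "c k = 0" "\<And>w. w < N \<Longrightarrow> w \<notin> {v, j, k} \<Longrightarrow> c w \<le> ln \<eta>"
proof -
  obtain \<alpha> \<beta> where dual: "(b j - b v) \<bullet> \<alpha> = 1" "(b k - b v) \<bullet> \<alpha> = 0" "(b j - b v) \<bullet> \<beta> = 0" "(b k - b v) \<bullet> \<beta> = 1"
    using tri_dual_basis[OF t] by blast
  define L where "L i = ln \<bar>a i\<bar>" for i
  define U where "U s K = (s - (L j - L v)) *\<^sub>R \<alpha> + (- K - (L k - L v)) *\<^sub>R \<beta>" for s K
  \<comment> \<open>The deviation of the height at \<open>w\<close> from the affine function through
    the heights at the triangle; domination bounds it by \<open>ln \<eta>\<close>.\<close>
  define c where "c w = L w - L v - bcoord m n v j k w * (L j - L v) - bcoord m n v k j w * (L k - L v)" for w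
  note vert = bcoord_vertex[OF t] bcoord_vertex[OF tri_swap(1)[OF t]]
  show ?thesis
  proof (rule that)
    show "continuous_on UNIV (\<lambda>s. U s K)" for K unfolding U_def by (intro continuous_intros)
    show "X v w (U s K) = exp (c w + bcoord m n v j k w * s - bcoord m n v k j w * K)" for w and s K :: real
    proof -
      have "E w (U s K) - E v (U s K) = L w - L v + (b w - b v) \<bullet> U s K"
        unfolding E_def L_def by (simp add: inner_diff_left)
      also have "(b w - b v) \<bullet> U s K = bcoord m n v j k w * (s - (L j - L v)) + bcoord m n v k j w * (- K - (L k - L v))"
        unfolding U_def bcoord_vec[OF t, of w] by (simp add: inner_add_left inner_add_right dual)
      finally show ?thesis unfolding X_def c_def by (simp add: algebra_simps)
    qed
    show "c v = 0" "c j = 0" "c k = 0" using vert by (simp_all add: c_def)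
    show "c w \<le> ln \<eta>" if "w < N" "w \<notin> {v, j, k}" for w
      using dominated[OF t that] unfolding c_def L_def by simp
  qed
qed

lemma N_pos: "tri v i j \<Longrightarrow> real N > 0"
  using tri_less(1) by (metis gr_zeroI not_less_zero of_nat_0_less_iff)

text \<open>The form of the smallness condition suited to the strip where \<open>X v j\<close> lies
  between 1/2 and 2.\<close>

lemma two_powr_M_le:
  assumes "N > 0" shows "\<eta> * 2 powr M \<le> 1 / (8 * real N)"
proof -
  have N: "real N > 0" using assms by simp
  have "2 powr M \<le> 3 powr M" using M(1) by (intro powr_mono2) auto
  also have "\<dots> \<le> 3 powr (2 * M)" using M(1) by (intro powr_mono) auto
  finally have "\<eta> * 2 powr M \<le> \<eta> * 3 powr (2 * M)" using \<eta>(1) by simp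
  moreover have "8 * real N * (\<eta> * 3 powr (2 * M)) \<le> 8 * real N * M\<^sup>2 * (\<eta> * 3 powr (2 * M))"
    using M(1) \<eta>(1) by (intro mult_right_mono) (auto simp: mult_left_le_one_le mult_le_cancel_left1)
  ultimately have "8 * real N * (\<eta> * 2 powr M) \<le> 1"
    using \<eta>(2) N by (smt (verit) mult_left_mono)
  then show ?thesis using N by (simp add: field_simps)
qed

text \<open>There are at most \<open>N\<close> other monomials, so those of each sign contribute at
  most 1/8, and \<open>X v j u - 1\<close> decides the sign of \<open>\<Phi> v u\<close>.\<close>

lemma \<Phi>_sign_change:
  assumes t: "tri v j k" and small: "\<And>w. w < N \<Longrightarrow> w \<notin> {v, j} \<Longrightarrow> X v w u \<le> 1 / (8 * real N)"
  shows "\<bar>\<Phi> v u - (X v j u - 1)\<bar> \<le> 1/4" "S v u \<le> X v j u + 1/8"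
proof -
  have N: "real N > 0" using N_pos[OF t] .
  have sum_le: "(\<Sum>w\<in>A. X v w u) \<le> 1/8" if A: "A \<subseteq> {..<N} - {v, j}" for A
  proof -
    have "(\<Sum>w\<in>A. X v w u) \<le> real (card A) * (1 / (8 * real N))"
      using A small by (intro sum_bounded_above) auto
    also have "\<dots> \<le> real N * (1 / (8 * real N))"
      using card_mono[of "{..<N}" A] A by (intro mult_right_mono) auto
    finally show ?thesis using N by simp
  qed
  have "S v u = X v j u + (\<Sum>w\<in>pos v - {j}. X v w u)"
    unfolding S_def using tri_pos(1)[OF t] by (simp add: sum.remove)
  moreover have "(\<Sum>w\<in>pos v - {j}. X v w u) \<le> 1/8" "(\<Sum>w\<in>minority v. X v w u) \<le> 1/8"
    using tri_pos(1)[OF t] by (intro sum_le; auto simp: pos_def minority_def same_class_def)+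
  moreover have "(\<Sum>w\<in>pos v - {j}. X v w u) \<ge> 0" "(\<Sum>w\<in>minority v. X v w u) \<ge> 0"
    by (intro sum_nonneg; simp)+
  ultimately show "\<bar>\<Phi> v u - (X v j u - 1)\<bar> \<le> 1/4" "S v u \<le> X v j u + 1/8"
    unfolding \<Phi>_def by linarith+
qed

text \<open>Dividing by the absolute value of the \<open>v\<close>-th monomial gives representatives
  that can converge to a nonzero vector.\<close>

lemma point_eq_scaled:
  assumes "v < N"
  shows "point v u = line_of (\<lambda>i. if i < N then msign v i / \<bar>a i\<bar> * X v i u else 0)"
proof -
  have "(\<lambda>i. if i < N then msign v i / \<bar>a i\<bar> * X v i u else 0)
      = (\<lambda>i. exp (- E v u) * monomial_map N m n (sgx v * exp (fst u)) (sgy v * exp (snd u)) i)"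
  proof
    fix i
    show "(if i < N then msign v i / \<bar>a i\<bar> * X v i u else 0)
      = exp (- E v u) * monomial_map N m n (sgx v * exp (fst u)) (sgy v * exp (snd u)) i"
    proof (cases "i < N")
      case True
      then show ?thesis using monomial_eq[OF True, of v u] by (simp add: X_def exp_diff exp_minus field_simps)
    next
      case False
      then show ?thesis by (simp add: monomial_map_def)
    qed
  qed
  then show ?thesis unfolding point_def by (simp add: line_of_scale)
qed

text \<open>For each large \<open>K\<close>, the intermediate value theorem in \<open>s\<close>
  between \<open>- ln 2\<close> and \<open>ln 2\<close> gives a point of the branch. Compactness
  yields a limit in \<open>s\<close>, while \<open>K\<close> tending to infinity kills every
  monomial off the line of the edge. In the limit the ratios at \<open>v\<close> and
  \<open>j\<close> are at least 1/2, all others at most 1/8.\<close>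

lemma arc_axis_point:
  assumes t: "tri v j k" and nonneg: "\<And>w. w < N \<Longrightarrow> bcoord m n v k j w \<ge> 0"
  shows "\<exists>z\<in>arc v. dominant_on {v, j} z \<and>
    (\<forall>V\<in>z. \<forall>i<N. bcoord m n v k j i \<noteq> 0 \<longrightarrow> V i = 0)"
proof -
  have v: "v < N" and j: "j < N" and N: "real N > 0" "N > 0"
    using tri_less[OF t] N_pos[OF t] by auto
  note vert = bcoord_vertex[OF t] bcoord_vertex[OF tri_swap(1)[OF t]]
  obtain U :: "real \<Rightarrow> real \<Rightarrow> real \<times> real" and c :: "nat \<Rightarrow> real" where U: "\<And>K. continuous_on UNIV (\<lambda>s. U s K)"
    "\<And>w (s::real) (K::real). X v w (U s K) = exp (c w + bcoord m n v j k w * s - bcoord m n v k j w * K)"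
    "c v = 0" "c j = 0" "c k = 0" "\<And>w. w < N \<Longrightarrow> w \<notin> {v, j, k} \<Longrightarrow> c w \<le> ln \<eta>"
    using tri_coordinates[OF t] by blast
  have bound: "c w + bcoord m n v j k w * s - bcoord m n v k j w * K \<le> ln (1 / (8 * real N))"
    if w: "w < N" "w \<notin> {v, j}" and s: "s \<in> {- ln 2..ln 2}" and K: "K \<ge> ln (8 * real N)" for w and s K :: real
  proof (cases "w = k")
    case True
    then show ?thesis using K vert U(5) N by (simp add: ln_div)
  next
    case False
    have "ln (8 * real N) \<ge> 0" using N by (intro ln_ge_zero) simp
    then have K': "bcoord m n v k j w * K \<ge> 0"
      using nonneg[OF w(1)] K by (intro mult_nonneg_nonneg) auto
    have "bcoord m n v j k w * s \<le> \<bar>real_of_int (bcoord m n v j k w)\<bar> * \<bar>s\<bar>"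
      by (metis abs_ge_self abs_mult)
    also have "\<dots> \<le> M * ln 2" using M s w t by (intro mult_mono) auto
    finally have "c w + bcoord m n v j k w * s - bcoord m n v k j w * K \<le> ln \<eta> + M * ln 2"
      using U(6)[of w] w False K' by fastforce
    also have "\<dots> = ln (\<eta> * 2 powr M)" using \<eta>(1) by (simp add: ln_mult ln_powr)
    also have "\<dots> \<le> ln (1 / (8 * real N))"
      using two_powr_M_le[OF N(2)] \<eta>(1) N by (subst ln_le_cancel_iff) auto
    finally show ?thesis .
  qed
  have Xj: "X v j (U s K) = exp s" for s K using U(2,4) vert by simp
  define Kn where "Kn r = ln (8 * real N) + real r" for r :: nat
  have small: "X v w (U s (Kn r)) \<le> 1 / (8 * real N)"
    if "w < N" "w \<notin> {v, j}" "s \<in> {- ln 2..ln 2}" for w s r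
  proof -
    have "X v w (U s (Kn r)) \<le> exp (ln (1 / (8 * real N)))"
      unfolding U(2) using bound[OF that, of "Kn r"] by (simp add: Kn_def)
    then show ?thesis using N by simp
  qed
  have "\<exists>s\<in>{- ln 2..ln 2}. U s (Kn r) \<in> branch v" for r
  proof -
    have est: "\<bar>\<Phi> v (U s (Kn r)) - (exp s - 1)\<bar> \<le> 1/4" "S v (U s (Kn r)) \<le> exp s + 1/8"
      if "s \<in> {- ln 2..ln 2}" for s
      using \<Phi>_sign_change[OF t, of "U s (Kn r)"] small that Xj by auto
    have ln2: "ln 2 \<ge> (0::real)" by simp
    have "continuous_on {- ln 2..ln 2} (\<lambda>s. \<Phi> v (U s (Kn r)))"
      by (rule continuous_on_compose2[OF \<Phi>_continuous continuous_on_subset[OF U(1)]]) auto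
    moreover have "\<Phi> v (U (- ln 2) (Kn r)) \<le> 0"
    proof -
      have "exp (- ln 2) = (1/2::real)" by (simp add: exp_minus)
      moreover have "\<bar>\<Phi> v (U (- ln 2) (Kn r)) - (exp (- ln 2) - 1)\<bar> \<le> 1/4"
        using est(1)[of "- ln 2"] ln2 by simp
      ultimately show ?thesis by linarith
    qed
    moreover have "0 \<le> \<Phi> v (U (ln 2) (Kn r))"
    proof -
      have "\<bar>\<Phi> v (U (ln 2) (Kn r)) - (2 - 1)\<bar> \<le> 1/4" using est(1)[of "ln 2"] ln2 by simp
      then show ?thesis by linarith
    qed
    ultimately obtain s where s: "s \<in> {- ln 2..ln 2}" "\<Phi> v (U s (Kn r)) = 0"
      using IVT'[of "\<lambda>s. \<Phi> v (U s (Kn r))" "- ln 2" 0 "ln 2"] ln2 by auto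
    have "exp s \<le> 2" using s(1) by (metis atLeastAtMost_iff exp_le_cancel_iff exp_ln zero_less_numeral)
    then have "S v (U s (Kn r)) \<le> 3" using est(2)[OF s(1)] by linarith
    then show ?thesis using s unfolding branch_def by auto
  qed
  then obtain sn where sn: "\<And>r. sn r \<in> {- ln 2..ln 2}" "\<And>r. U (sn r) (Kn r) \<in> branch v"
    by metis
  have "compact {- ln 2..ln 2::real}" by simp
  then obtain s h where s: "s \<in> {- ln 2..ln 2}" "strict_mono (h::nat \<Rightarrow> nat)" "(sn \<circ> h) \<longlonglongrightarrow> s"
    using sn(1) unfolding compact_def by blast
  \<comment> \<open>The limiting ratios: those on the line through \<open>b v\<close> and
    \<open>b j\<close> survive, the others tend to 0.\<close>
  define Y where "Y w = (if bcoord m n v k j w = 0 then exp (c w + bcoord m n v j k w * s) else 0)" for w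
  have limX: "(\<lambda>r. X v w (U (sn (h r)) (Kn (h r)))) \<longlonglongrightarrow> Y w" if w: "w < N" for w
  proof -
    have lim1: "(\<lambda>r. c w + bcoord m n v j k w * sn (h r)) \<longlonglongrightarrow> c w + bcoord m n v j k w * s"
      using s(3) by (auto intro!: tendsto_intros simp: o_def)
    show ?thesis
    proof (cases "bcoord m n v k j w = 0")
      case True
      then show ?thesis unfolding U(2) Y_def using lim1 by (auto intro!: tendsto_intros)
    next
      case False
      then have be: "real_of_int (bcoord m n v k j w) > 0" using nonneg[OF w] by simp
      have "filterlim (\<lambda>r. real (h r)) at_top sequentially"
        using filterlim_compose[OF filterlim_real_sequentially filterlim_subseq[OF s(2)]] .
      then have "filterlim (\<lambda>r. ln (8 * real N) + real (h r)) at_top sequentially"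
        by (rule filterlim_tendsto_add_at_top[OF tendsto_const])
      then have "filterlim (\<lambda>r. bcoord m n v k j w * Kn (h r)) at_top sequentially"
        unfolding Kn_def by (intro filterlim_tendsto_pos_mult_at_top[OF tendsto_const be])
      then have "filterlim (\<lambda>r. - (c w + bcoord m n v j k w * sn (h r)) + bcoord m n v k j w * Kn (h r)) at_top sequentially"
        by (rule filterlim_tendsto_add_at_top[OF tendsto_minus[OF lim1]])
      then have "filterlim (\<lambda>r. c w + bcoord m n v j k w * sn (h r) - bcoord m n v k j w * Kn (h r)) at_bot sequentially"
        by (simp add: filterlim_uminus_at_bot algebra_simps)
      then have "(\<lambda>r. exp (c w + bcoord m n v j k w * sn (h r) - bcoord m n v k j w * Kn (h r))) \<longlonglongrightarrow> 0"
        by (rule filterlim_compose[OF exp_at_bot])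
      then show ?thesis unfolding U(2) Y_def using False by simp
    qed
  qed
  define V where "V i = (if i < N then msign v i / \<bar>a i\<bar> * Y i else 0)" for i
  have Yv: "Y v = 1" and Yj: "Y j = exp s" using U(3,4) vert by (simp_all add: Y_def)
  have aV: "\<bar>a i * V i\<bar> = \<bar>Y i\<bar>" if i: "i < N" for i
  proof -
    have "a i \<noteq> 0" using a_nonzero[OF i] .
    then show ?thesis using i by (simp add: V_def abs_mult)
  qed
  have V_top: "V \<in> topspace (Euclidean_space N)" "V \<noteq> (\<lambda>i. 0)"
  proof -
    show "V \<in> topspace (Euclidean_space N)" by (simp add: V_def topspace_Euclidean_space)
    have "\<bar>a v * V v\<bar> = 1" using aV[OF v] Yv by simp
    then show "V \<noteq> (\<lambda>i. 0)" by auto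
  qed
  have "line_of V \<in> arc v"
    unfolding arc_def
  proof (rule line_of_limit_in_closure[OF V_top])
    let ?X = "\<lambda>r i. if i < N then msign v i / \<bar>a i\<bar> * X v i (U (sn (h r)) (Kn (h r))) else 0"
    show "(\<lambda>r. ?X r i) \<longlonglongrightarrow> V i" for i
      unfolding V_def using tendsto_mult[OF tendsto_const limX, of i "msign v i / \<bar>a i\<bar>"] by auto
    show "?X r \<in> topspace (Euclidean_space N)" for r by (simp add: topspace_Euclidean_space)
    show "line_of (?X r) \<in> point v ` branch v" for r
      using sn(2) point_eq_scaled[OF v] by blast
  qed
  moreover have "dominant_on {v, j} (line_of V)"
    unfolding dominant_on_def
  proof (intro ballI allI impI)
    fix W i w assume W: "W \<in> line_of V" and "i \<in> {v, j}" and w: "w < N" and "w \<notin> {v, j}"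
    then have i: "i = v \<or> i = j" and w: "w < N" "w \<noteq> v" "w \<noteq> j" by auto
    obtain d where d: "d \<noteq> 0" "W = (\<lambda>i. d * V i)" using W unfolding line_of_def by blast
    have iN: "i < N" using i v j by auto
    have "exp (- ln 2) \<le> exp s" using s(1) by simp
    then have "1/2 \<le> \<bar>Y i\<bar>" using i Yv Yj by (auto simp: exp_minus)
    moreover have "\<bar>Y w\<bar> \<le> 1/8"
    proof (cases "bcoord m n v k j w = 0")
      case True
      have "Y w \<le> exp (ln (1 / (8 * real N)))"
        unfolding Y_def exp_le_cancel_iff if_P[OF True]
        using bound[OF w(1) _ s(1), of "ln (8 * real N)"] w True by simp
      also have "\<dots> \<le> 1/8" using N by (simp add: field_simps)
      finally show ?thesis by (simp add: Y_def)
    qed (simp add: Y_def)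
    ultimately have "\<bar>a w * V w\<bar> < \<bar>a i * V i\<bar>" using aV[OF w(1)] aV[OF iN] by simp
    then have "\<bar>d\<bar> * \<bar>a w * V w\<bar> < \<bar>d\<bar> * \<bar>a i * V i\<bar>" using d(1) by (intro mult_strict_left_mono) auto
    then show "\<bar>a w * W w\<bar> < \<bar>a i * W i\<bar>" by (simp add: d(2) abs_mult mult_ac)
  qed
  moreover have "\<forall>W\<in>line_of V. \<forall>i<N. bcoord m n v k j i \<noteq> 0 \<longrightarrow> W i = 0"
    unfolding line_of_def by (auto simp: V_def Y_def)
  ultimately show ?thesis by blast
qed

end

section \<open>Points of the curve on the axes\<close>

context harnack_curve
begin

lemma curve_in_proj_points: "z \<in> curve \<Longrightarrow> z \<in> proj_points N"
  unfolding curve_def using closure_of_subset_topspace by fastforce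

lemma monomial_in_proj_points:
  assumes "x \<noteq> 0" "y \<noteq> 0"
  shows "line_of (monomial_map N m n x y) \<in> proj_points N"
  unfolding proj_points_def using monomial_map_point[OF assms N_positive] by blast

text \<open>In the projective embedding the curve is cut out on the torus by a hyperplane, and this
  linear condition is closed.\<close>

lemma curve_linear_form:
  assumes "z \<in> curve" "V \<in> z"
  shows "(\<Sum>i<N. a i * V i) = 0"
proof (rule closure_homogeneous[where f = "\<lambda>V. \<Sum>i<N. a i * V i"])
  show "continuous_on UNIV (\<lambda>V. \<Sum>i<N. a i * V i)"
    by (intro continuous_intros continuous_on_product_coordinates)
  show "(\<Sum>i<N. a i * (c * v i)) = 0 \<longleftrightarrow> (\<Sum>i<N. a i * v i) = 0" if "c \<noteq> 0" for c v
  proof -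
    have "(\<Sum>i<N. a i * (c * v i)) = c * (\<Sum>i<N. a i * v i)" by (simp add: sum_distrib_left mult_ac)
    then show ?thesis using that by simp
  qed
  show "z \<in> proj_space N closure_of {line_of (monomial_map N m n x y) | x y.
     x \<noteq> 0 \<and> y \<noteq> 0 \<and> (\<Sum>i<N. a i * x powi m i * y powi n i) = 0}"
    using assms(1) unfolding curve_def .
next
  fix z assume "z \<in> {line_of (monomial_map N m n x y) | x y.
     x \<noteq> 0 \<and> y \<noteq> 0 \<and> (\<Sum>i<N. a i * x powi m i * y powi n i) = 0}"
  then obtain x y where xy: "z = line_of (monomial_map N m n x y)" "x \<noteq> 0" "y \<noteq> 0"
    "(\<Sum>i<N. a i * x powi m i * y powi n i) = 0" by blast
  then have "(\<Sum>i<N. a i * monomial_map N m n x y i) = 0"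
    by (simp add: monomial_map_def mult.assoc)
  then show "\<exists>v. z = line_of v \<and> z \<in> proj_points N \<and> (\<Sum>i<N. a i * v i) = 0"
    using xy monomial_in_proj_points by blast
qed (rule assms(2))

text \<open>These quadratic binomials of the toric ideal hold on the torus because exponents add,
  and pass to the closure.\<close>

lemma toric_binomial:
  assumes z: "z \<in> real_toric_surface N m n" "V \<in> z"
    and ijkl: "i < N" "j < N" "k < N" "l < N" "m i + m j = m k + m l" "n i + n j = n k + n l"
  shows "V i * V j = V k * V l"
proof -
  have "V i * V j - V k * V l = 0"
  proof (rule closure_homogeneous[where f = "\<lambda>V. V i * V j - V k * V l"])
    show "continuous_on UNIV (\<lambda>V :: nat \<Rightarrow> real. V i * V j - V k * V l)"
      by (intro continuous_intros continuous_on_product_coordinates)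
    show "c * v i * (c * v j) - c * v k * (c * v l) = 0 \<longleftrightarrow> v i * v j - v k * v l = 0"
      if "c \<noteq> 0" for c :: real and v :: "nat \<Rightarrow> real"
    proof -
      have "c * v i * (c * v j) - c * v k * (c * v l) = c\<^sup>2 * (v i * v j - v k * v l)"
        by (simp add: power2_eq_square algebra_simps)
      then show ?thesis using that by simp
    qed
    show "z \<in> proj_space N closure_of {line_of (monomial_map N m n x y) | x y. x \<noteq> 0 \<and> y \<noteq> 0}"
      using z(1) unfolding real_toric_surface_def .
  next
    fix z assume "z \<in> {line_of (monomial_map N m n x y) | x y. x \<noteq> 0 \<and> y \<noteq> 0}"
    then obtain x y where xy: "z = line_of (monomial_map N m n x y)" "x \<noteq> 0" "y \<noteq> 0" by blast
    let ?V = "monomial_map N m n x y"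
    have "?V i * ?V j = x powi (m i + m j) * y powi (n i + n j)" "?V k * ?V l = x powi (m k + m l) * y powi (n k + n l)"
      using ijkl(1-4) xy(2,3) by (simp_all add: monomial_map_def power_int_add mult_ac)
    then have "?V i * ?V j - ?V k * ?V l = 0" using ijkl(5,6) by simp
    then show "\<exists>v. z = line_of v \<and> z \<in> proj_points N \<and> v i * v j - v k * v l = 0"
      using xy monomial_in_proj_points by blast
  qed (rule z(2))
  then show ?thesis by simp
qed

text \<open>The binomials force the coordinates along the side into a geometric progression. If the
  first vanished, all but the last would vanish, and the linear form would kill the last as
  well.\<close>

lemma axis_point_geometric:
  assumes \<iota>: "d > 0" "bij_betw \<iota> {..d} (side_indices N m n F)"
    "\<And>l. l \<le> d \<Longrightarrow> m (\<iota> l) = m (\<iota> 0) + int l * e1"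
    "\<And>l. l \<le> d \<Longrightarrow> n (\<iota> l) = n (\<iota> 0) + int l * e2"
    and z: "z \<in> curve" "z \<in> axis N m n F" "V \<in> z" and V: "V \<in> topspace (Euclidean_space N)" "V \<noteq> (\<lambda>i. 0)"
  shows "V (\<iota> 0) \<noteq> 0" "\<And>l. l \<le> d \<Longrightarrow> V (\<iota> l) = V (\<iota> 0) * (V (\<iota> 1) / V (\<iota> 0)) ^ l"
    "(\<Sum>l\<le>d. a (\<iota> l) * (V (\<iota> 1) / V (\<iota> 0)) ^ l) = 0"
proof -
  have off: "V i = 0" if "i \<notin> side_indices N m n F" for i
    using z(2,3) V(1) that unfolding axis_def topspace_Euclidean_space by (cases "i < N") auto
  have less: "\<iota> l < N" if "l \<le> d" for l
    using \<iota>(2) that unfolding bij_betw_def side_indices_def by auto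
  have rel: "V (\<iota> i) * V (\<iota> j) = V (\<iota> k) * V (\<iota> l)" if "i \<le> d" "j \<le> d" "k \<le> d" "l \<le> d" "i + j = k + l" for i j k l
  proof -
    have "int i + int j = int k + int l" using that(5) by linarith
    then have "int i * e + int j * e = int k * e + int l * e" for e by (metis distrib_right)
    note lin = this
    have "m (\<iota> i) + m (\<iota> j) = m (\<iota> k) + m (\<iota> l)"
      unfolding \<iota>(3)[OF that(1)] \<iota>(3)[OF that(2)] \<iota>(3)[OF that(3)] \<iota>(3)[OF that(4)]
      using lin[of e1] by linarith
    moreover have "n (\<iota> i) + n (\<iota> j) = n (\<iota> k) + n (\<iota> l)"
      unfolding \<iota>(4)[OF that(1)] \<iota>(4)[OF that(2)] \<iota>(4)[OF that(3)] \<iota>(4)[OF that(4)]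
      using lin[of e2] by linarith
    ultimately show ?thesis
      using toric_binomial[OF _ z(3)] z(1) curve_subset_toric_surface less that(1-4) by blast
  qed
  have sum_eq: "(\<Sum>l\<le>d. a (\<iota> l) * V (\<iota> l)) = 0"
  proof -
    have "0 = (\<Sum>i<N. a i * V i)" using curve_linear_form[OF z(1,3)] by simp
    also have "\<dots> = (\<Sum>i\<in>side_indices N m n F. a i * V i)"
      by (rule sum.mono_neutral_right) (auto simp: side_indices_def off)
    also have "\<dots> = (\<Sum>l\<le>d. a (\<iota> l) * V (\<iota> l))"
      using \<iota>(2) by (rule sum.reindex_bij_betw[symmetric])
    finally show ?thesis by simp
  qed
  show nz: "V (\<iota> 0) \<noteq> 0"
  proof
    assume 0: "V (\<iota> 0) = 0"
    have "l < d \<longrightarrow> V (\<iota> l) = 0" for l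
    proof (induction l)
      case (Suc l)
      show ?case
      proof
        assume l: "Suc l < d"
        then have "V (\<iota> (Suc l)) * V (\<iota> (Suc l)) = V (\<iota> l) * V (\<iota> (Suc (Suc l)))" by (intro rel) auto
        then show "V (\<iota> (Suc l)) = 0" using Suc l by simp
      qed
    qed (use 0 in simp)
    moreover from this have "(\<Sum>l\<le>d. a (\<iota> l) * V (\<iota> l)) = (\<Sum>l\<in>{d}. a (\<iota> l) * V (\<iota> l))"
      by (intro sum.mono_neutral_right) auto
    then have "V (\<iota> d) = 0" using sum_eq a_nonzero[OF less[of d]] by simp
    ultimately have "V (\<iota> l) = 0" if "l \<le> d" for l using that by (cases "l = d") auto
    then have "V i = 0" if "i \<in> \<iota> ` {..d}" for i using that by auto
    then have "V i = 0" for i using off[of i] bij_betw_imp_surj_on[OF \<iota>(2)] by blast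
    then show False using V(2) by auto
  qed
  show geo: "V (\<iota> l) = V (\<iota> 0) * (V (\<iota> 1) / V (\<iota> 0)) ^ l" if "l \<le> d" for l
    using that
  proof (induction l)
    case (Suc l)
    have "V (\<iota> (Suc l)) * V (\<iota> 0) = V (\<iota> l) * V (\<iota> 1)" using Suc.prems \<iota>(1) by (intro rel) auto
    then have "V (\<iota> (Suc l)) = V (\<iota> l) * (V (\<iota> 1) / V (\<iota> 0))" using nz by (simp add: field_simps)
    then show ?case using Suc by simp
  qed simp
  have "(\<Sum>l\<le>d. a (\<iota> l) * V (\<iota> l)) = V (\<iota> 0) * (\<Sum>l\<le>d. a (\<iota> l) * (V (\<iota> 1) / V (\<iota> 0)) ^ l)"
    unfolding sum_distrib_left
  proof (rule sum.cong)
    fix l assume "l \<in> {..d}"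
    then have "V (\<iota> l) = V (\<iota> 0) * (V (\<iota> 1) / V (\<iota> 0)) ^ l" by (intro geo) simp
    then show "a (\<iota> l) * V (\<iota> l) = V (\<iota> 0) * (a (\<iota> l) * (V (\<iota> 1) / V (\<iota> 0)) ^ l)"
      by (metis mult.left_commute)
  qed simp
  then show "(\<Sum>l\<le>d. a (\<iota> l) * (V (\<iota> 1) / V (\<iota> 0)) ^ l) = 0" using sum_eq nz by simp
qed

text \<open>The ratio of the progression is a root of the side polynomial and determines the point,
  since all coordinates off the side vanish.\<close>

lemma axis_points_bound:
  assumes \<iota>: "d > 0" "bij_betw \<iota> {..d} (side_indices N m n F)"
    "\<And>l. l \<le> d \<Longrightarrow> m (\<iota> l) = m (\<iota> 0) + int l * e1"
    "\<And>l. l \<le> d \<Longrightarrow> n (\<iota> l) = n (\<iota> 0) + int l * e2"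
  shows "finite (curve \<inter> axis N m n F)" "card (curve \<inter> axis N m n F) \<le> d"
proof -
  let ?Z = "curve \<inter> axis N m n F" and ?R = "{t. (\<Sum>l\<le>d. a (\<iota> l) * t ^ l) = 0}"
  have "\<forall>z\<in>?Z. \<exists>V. V \<in> topspace (Euclidean_space N) \<and> V \<noteq> (\<lambda>i. 0) \<and> z = line_of V"
    using curve_in_proj_points unfolding proj_points_def by blast
  from bchoice[OF this] obtain r where r: "\<And>z. z \<in> ?Z \<Longrightarrow> r z \<in> topspace (Euclidean_space N)"
    "\<And>z. z \<in> ?Z \<Longrightarrow> r z \<noteq> (\<lambda>i. 0)" "\<And>z. z \<in> ?Z \<Longrightarrow> z = line_of (r z)" by blast
  have rz: "r z \<in> z" if "z \<in> ?Z" for z using r(3)[OF that] self_in_line_of by metis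
  define t where "t z = r z (\<iota> 1) / r z (\<iota> 0)" for z
  have nz: "r z (\<iota> 0) \<noteq> 0" and geo: "\<And>l. l \<le> d \<Longrightarrow> r z (\<iota> l) = r z (\<iota> 0) * t z ^ l"
    and root: "t z \<in> ?R" if z: "z \<in> ?Z" for z
  proof -
    have zc: "z \<in> curve" "z \<in> axis N m n F" using z by blast+
    note geometric = axis_point_geometric[OF \<iota> zc rz[OF z] r(1,2)[OF z]]
    show "r z (\<iota> 0) \<noteq> 0" by (rule geometric(1))
    show "r z (\<iota> l) = r z (\<iota> 0) * t z ^ l" if "l \<le> d" for l
      unfolding t_def by (rule geometric(2)) (use that in simp_all)
    show "t z \<in> ?R" unfolding t_def mem_Collect_eq by (rule geometric(3))
  qed
  have "inj_on t ?Z"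
  proof (rule inj_onI)
    fix x y assume x: "x \<in> ?Z" and y: "y \<in> ?Z" and eq: "t x = t y"
    define c where "c = r y (\<iota> 0) / r x (\<iota> 0)"
    have c: "c \<noteq> 0" using nz x y by (simp add: c_def)
    have "r y i = c * r x i" for i
    proof (cases "i \<in> side_indices N m n F")
      case True
      then obtain l where l: "l \<le> d" "i = \<iota> l" using \<iota>(2) unfolding bij_betw_def by auto
      then have "r y i = r y (\<iota> 0) * t x ^ l" "r x i = r x (\<iota> 0) * t x ^ l"
        using geo[OF x l(1)] geo[OF y l(1)] eq by simp_all
      then show ?thesis using nz[OF x] by (simp add: c_def)
    next
      case False
      have "r z i = 0" if z: "z \<in> ?Z" for z
        using z rz[OF z] r(1)[OF z] False unfolding axis_def topspace_Euclidean_space by (cases "i < N") auto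
      then show ?thesis using x y by simp
    qed
    then have "r y = (\<lambda>i. c * r x i)" by blast
    then show "x = y" using r(3)[OF x] r(3)[OF y] line_of_scale[OF c] by metis
  qed
  moreover have "t ` ?Z \<subseteq> ?R" using root by blast
  moreover have "finite ?R \<and> card ?R \<le> d"
  proof -
    have "\<iota> 0 < N" using \<iota>(2) unfolding bij_betw_def side_indices_def by auto
    \<comment> \<open>The constant coefficient shows that the side polynomial is not zero.\<close>
    then have "a (\<iota> 0) \<noteq> 0" by (rule a_nonzero)
    then show ?thesis using Transcendental.polyfun_rootbound[where c = "\<lambda>l. a (\<iota> l)" and k = 0 and n = d] by blast
  qed
  ultimately show "finite ?Z" "card ?Z \<le> d"
    using inj_on_finite[of t ?Z ?R] card_inj_on_le[of t ?Z ?R] by auto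
qed

section \<open>Unit edges and the points they carry\<close>

lemma supports_exists:
  assumes "is_side (polygon N m n) F" "v < N" "b v \<in> F"
  obtains \<nu> where "supports v \<nu>"
proof -
  obtain \<nu> c where \<nu>: "\<nu> \<noteq> 0" "\<And>z. z \<in> polygon N m n \<Longrightarrow> \<nu> \<bullet> z \<le> c"
    "\<And>z. z \<in> polygon N m n \<Longrightarrow> z \<in> F \<longleftrightarrow> \<nu> \<bullet> z = c" using side_normal[OF assms(1)] by blast
  have "\<nu> \<bullet> b v = c" using \<nu>(3)[OF b_in_polygon[OF assms(2)]] assms(3) by simp
  then have "supports v \<nu>"
    unfolding supports_def using \<nu>(1) \<nu>(2)[OF b_in_polygon] by (simp add: inner_diff_flip)
  then show ?thesis using that by blast
qed

lemma edge_point: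
  assumes F: "is_side (polygon N m n) F" "b v \<in> F" "b j \<in> F" and t: "tri v j k"
  shows "\<exists>z. z \<in> arc v \<and> z \<in> curve \<inter> axis N m n F \<and> dominant_on {v, j} z"
proof -
  obtain z where z: "z \<in> arc v" "dominant_on {v, j} z"
    "\<forall>V\<in>z. \<forall>i<N. bcoord m n v k j i \<noteq> 0 \<longrightarrow> V i = 0"
    using arc_axis_point[OF t] side_tri(1)[OF F(1) t F(2,3)] by blast
  have "z \<in> curve" using z(1) arc_subset_curve[OF tri_less(1)[OF t]] by blast
  moreover have "z \<in> axis N m n F"
    unfolding axis_def side_indices_def
    using z(3) side_tri(2)[OF F(1) t F(2,3)] \<open>z \<in> curve\<close> curve_subset_toric_surface by auto
  ultimately show ?thesis using z by blast
qed

text \<open>Distinct sets of equal size each have an element outside the other, and each of these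
  two monomials would strictly dominate the other.\<close>

lemma dominant_unique:
  assumes "dominant_on e z" "dominant_on e' z" "z \<in> curve" "e \<subseteq> {..<N}" "e' \<subseteq> {..<N}" "card e = card e'"
  shows "e = e'"
proof (rule ccontr)
  assume ne: "e \<noteq> e'"
  obtain V where V: "V \<in> z"
    using curve_in_proj_points[OF assms(3)] self_in_line_of unfolding proj_points_def by blast
  have fin: "finite e" "finite e'" using assms(4,5) by (auto intro: finite_subset)
  have "\<not> e \<subseteq> e'" "\<not> e' \<subseteq> e"
    using ne card_subset_eq[OF fin(2)] card_subset_eq[OF fin(1)] assms(6) by metis+
  then obtain i j where "i \<in> e" "i \<notin> e'" "j \<in> e'" "j \<notin> e" by blast
  then have "\<bar>a j * V j\<bar> < \<bar>a i * V i\<bar>" "\<bar>a i * V i\<bar> < \<bar>a j * V j\<bar>"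
    using assms(1,2,4,5) V unfolding dominant_on_def by blast+
  then show False by simp
qed

text \<open>The upper bound by the degree of the side polynomial and the lower bound by its unit edges agree,
  so each unit edge carries exactly one point of the curve.\<close>
lemma axis_points:
  assumes F: "is_side (polygon N m n) F"
  shows "finite (curve \<inter> axis N m n F)"
    and "card (curve \<inter> axis N m n F) = integer_length N m n F"
    and "curve \<inter> axis N m n F \<noteq> {}"
    and "\<And>z. z \<in> curve \<inter> axis N m n F \<Longrightarrow>
      \<exists>v j k. tri v j k \<and> b v \<in> F \<and> b j \<in> F \<and> dominant_on {v, j} z"
    and "\<And>z z' e. \<lbrakk>z \<in> curve \<inter> axis N m n F; z' \<in> curve \<inter> axis N m n F; dominant_on e z; dominant_on e z';
      e \<subseteq> {..<N}; card e = 2\<rbrakk> \<Longrightarrow> z = z'"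
proof -
  let ?Z = "curve \<inter> axis N m n F"
  obtain \<iota> :: "nat \<Rightarrow> nat" and d :: nat and e1 e2 :: int where \<iota>:
    "d > 0" "bij_betw \<iota> {..d} (side_indices N m n F)"
    "\<And>l. l \<le> d \<Longrightarrow> m (\<iota> l) = m (\<iota> 0) + int l * e1"
    "\<And>l. l \<le> d \<Longrightarrow> n (\<iota> l) = n (\<iota> 0) + int l * e2"
    "\<And>l. l < d \<Longrightarrow> \<exists>k. tri (\<iota> l) (\<iota> (Suc l)) k"
    by (rule side_progression[OF F], rule that)
  show fin: "finite ?Z" using axis_points_bound[OF \<iota>(1-4)] by simp
  let ?e = "\<lambda>l. {\<iota> l, \<iota> (Suc l)}"
  have side: "\<iota> l < N" "b (\<iota> l) \<in> F" if "l \<le> d" for l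
    using \<iota>(2) that unfolding bij_betw_def side_indices_def by auto
  have inj: "inj_on \<iota> {..d}" using \<iota>(2) unfolding bij_betw_def by blast
  have "\<forall>l\<in>{..<d}. \<exists>z. z \<in> ?Z \<and> dominant_on (?e l) z"
  proof
    fix l assume "l \<in> {..<d}"
    then have l: "l < d" by simp
    then obtain k where "tri (\<iota> l) (\<iota> (Suc l)) k" using \<iota>(5) by blast
    then show "\<exists>z. z \<in> ?Z \<and> dominant_on (?e l) z"
      using edge_point[OF F side(2) side(2), of l "Suc l" k] l by auto
  qed
  from bchoice[OF this] obtain g where g: "\<And>l. l < d \<Longrightarrow> g l \<in> ?Z" "\<And>l. l < d \<Longrightarrow> dominant_on (?e l) (g l)"
    by blast
  have e: "?e l \<subseteq> {..<N}" "card (?e l) = 2" if "l < d" for l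
  proof -
    show "?e l \<subseteq> {..<N}" using side(1) that by simp
    have "\<iota> l \<noteq> \<iota> (Suc l)" using inj_onD[OF inj, of l "Suc l"] that by auto
    then show "card (?e l) = 2" by simp
  qed
  have e_inj: "l = l'" if "l < d" "l' < d" "?e l = ?e l'" for l l'
  proof -
    have "\<iota> ` {l, Suc l} = \<iota> ` {l', Suc l'}" using that(3) by simp
    then have "{l, Suc l} = {l', Suc l'}"
      using inj_on_image_eq_iff[OF inj, of "{l, Suc l}" "{l', Suc l'}"] that by auto
    then show ?thesis by (auto simp: doubleton_eq_iff)
  qed
  have uniq: "e' = ?e l" if "l < d" "dominant_on e' (g l)" "e' \<subseteq> {..<N}" "card e' = 2" for e' l
    using dominant_unique[OF that(2) g(2)[OF that(1)]] g(1)[OF that(1)] e[OF that(1)] that by simp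
  have "inj_on g {..<d}"
  proof (rule inj_onI)
    fix l l' assume l: "l \<in> {..<d}" "l' \<in> {..<d}" "g l = g l'"
    then have "?e l' = ?e l" using uniq[of l "?e l'"] g(2)[of l'] e[of l'] by simp
    then show "l = l'" using e_inj l by auto
  qed
  then have "card (g ` {..<d}) = d" by (simp add: card_image)
  \<comment> \<open>The points found on the \<open>d\<close> unit edges are distinct, and there are
    at most \<open>d\<close> points in all.\<close>
  then have Z: "?Z = g ` {..<d}"
    using card_seteq[OF fin, of "g ` {..<d}"] g(1) axis_points_bound(2)[OF \<iota>(1-4)] by auto
  have "card (side_indices N m n F) = d + 1" using bij_betw_same_card[OF \<iota>(2)] by simp
  then show "card ?Z = integer_length N m n F"
    unfolding integer_length_def Z using \<open>card (g ` {..<d}) = d\<close> by simp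
  show "?Z \<noteq> {}" unfolding Z using \<iota>(1) by auto
  show "\<exists>v j k. tri v j k \<and> b v \<in> F \<and> b j \<in> F \<and> dominant_on {v, j} z" if z: "z \<in> ?Z" for z
  proof -
    obtain l where l: "l < d" "z = g l" using z unfolding Z by blast
    then show ?thesis using \<iota>(5)[OF l(1)] side(2)[of l] side(2)[of "Suc l"] g(2)[OF l(1)] by auto
  qed
  show "z = z'" if z: "z \<in> ?Z" "z' \<in> ?Z" "dominant_on e z" "dominant_on e z'" "e \<subseteq> {..<N}" "card e = 2" for z z' e
  proof -
    obtain l l' where l: "l < d" "z = g l" "l' < d" "z' = g l'" using z(1,2) unfolding Z by blast
    then have "?e l = ?e l'" using uniq[of l e] uniq[of l' e] z by simp
    then show ?thesis using e_inj l by blast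
  qed
qed

section \<open>Linking the axis points around the boundary\<close>

abbreviation curve_space :: "(nat \<Rightarrow> real) set topology" where
  "curve_space \<equiv> subtopology (proj_space N) curve"

lemma topspace_curve_space: "topspace curve_space = curve"
  using curve_in_proj_points by auto

text \<open>The arc of a common vertex is connected and contains the points of both edges.\<close>

lemma linked_points:
  assumes F: "is_side (polygon N m n) F" "b v \<in> F" "b j \<in> F" and t: "tri v j k"
    and F': "is_side (polygon N m n) F'" "b v' \<in> F'" "b j' \<in> F'" and t': "tri v' j' k'"
    and meet: "{v, j} \<inter> {v', j'} \<noteq> {}"
    and z: "z \<in> curve \<inter> axis N m n F" "dominant_on {v, j} z"
    and z': "z' \<in> curve \<inter> axis N m n F'" "dominant_on {v', j'} z'"
  shows "connected_component_of curve_space z z'"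
proof -
  obtain u where u: "u \<in> {v, j}" "u \<in> {v', j'}" using meet by blast
  \<comment> \<open>The arc of either vertex of an edge ends in the point of the curve on this edge, by uniqueness of
    that point.\<close>
  have on_arc: "z \<in> arc u"
    if F: "is_side (polygon N m n) F" "b v \<in> F" "b j \<in> F" and t: "tri v j k" and u: "u \<in> {v, j}"
      and z: "z \<in> curve \<inter> axis N m n F" "dominant_on {v, j} z" for F v j k z
  proof -
    obtain i where i: "{u, i} = {v, j}" "tri u i k" "b u \<in> F" "b i \<in> F"
      using u F t tri_swap(2)[OF t] by (metis insert_commute insertE singletonD)
    obtain y where y: "y \<in> arc u" "y \<in> curve \<inter> axis N m n F" "dominant_on {u, i} y"
      using edge_point[OF F(1) i(3,4,2)] by blast
    have "{v, j} \<subseteq> {..<N}" "card {v, j} = 2" using t tri_less[OF t] unfolding tri_def by auto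
    then have "y = z" using axis_points(5)[OF F(1) y(2) z(1), of "{v, j}"] y(3) z(2) i(1) by simp
    then show ?thesis using y(1) by simp
  qed
  have "z \<in> arc u" "z' \<in> arc u"
    using on_arc[OF F t u(1) z] on_arc[OF F' t' u(2) z'] by blast+
  moreover have uN: "u < N" "b u \<in> F" using u(1) F tri_less[OF t] by auto
  obtain \<nu> where "supports u \<nu>" by (rule supports_exists[OF F(1) uN])
  then have "connectedin curve_space (arc u)"
    using arc_connected[OF uN(1)] arc_subset_curve[OF uN(1)] by (simp add: connectedin_subtopology)
  ultimately show ?thesis unfolding connected_component_of_def by blast
qed

lemma axis_points_connected:
  assumes F: "is_side (polygon N m n) F" "z \<in> curve \<inter> axis N m n F"
    and F': "is_side (polygon N m n) F'" "z' \<in> curve \<inter> axis N m n F'"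
  shows "connected_component_of curve_space z z'"
proof -
  obtain v j k where e: "tri v j k" "b v \<in> F" "b j \<in> F" "dominant_on {v, j} z"
    using axis_points(4)[OF F] by blast
  obtain v' j' k' where e': "tri v' j' k'" "b v' \<in> F'" "b j' \<in> F'" "dominant_on {v', j'} z'"
    using axis_points(4)[OF F'] by blast
  \<comment> \<open>All sides and all dominant points are quantified over, because a boundary edge
    records neither its side nor its point.\<close>
  define Q where "Q v j \<longleftrightarrow> (\<forall>G y. is_side (polygon N m n) G \<and> b v \<in> G \<and> b j \<in> G \<and>
    y \<in> curve \<inter> axis N m n G \<and> dominant_on {v, j} y \<longrightarrow> connected_component_of curve_space z y)" for v j
  have "Q v' j'"
  proof (rule boundary_edge_induct)
    show "boundary_edge v j" "boundary_edge v' j'"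
      unfolding boundary_edge_def using F(1) F'(1) e e' by blast+
    show "Q v j" unfolding Q_def
    proof (intro allI impI, elim conjE)
      fix G y assume G: "is_side (polygon N m n) G" "b v \<in> G" "b j \<in> G"
        and y: "y \<in> curve \<inter> axis N m n G" "dominant_on {v, j} y"
      show "connected_component_of curve_space z y"
        by (rule linked_points[OF F(1) e(2,3,1) G e(1) _ F(2) e(4) y]) simp
    qed
  next
    fix v j v' j' assume edges: "boundary_edge v j" "boundary_edge v' j'"
      and meet: "{v, j} \<inter> {v', j'} \<noteq> {}" and Q: "Q v j"
    obtain G k where G: "is_side (polygon N m n) G" "b v \<in> G" "b j \<in> G" and t: "tri v j k"
      using edges(1) unfolding boundary_edge_def by blast
    obtain k' where t': "tri v' j' k'" using edges(2) unfolding boundary_edge_def by blast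
    \<comment> \<open>The point of the previous edge, through which the next one is linked to
      \<open>z\<close>.\<close>
    obtain x where x: "x \<in> curve \<inter> axis N m n G" "dominant_on {v, j} x"
      using edge_point[OF G t] by blast
    have zx: "connected_component_of curve_space z x" using Q G x unfolding Q_def by blast
    show "Q v' j'" unfolding Q_def
    proof (intro allI impI, elim conjE)
      fix G' y assume G': "is_side (polygon N m n) G'" "b v' \<in> G'" "b j' \<in> G'"
        and y: "y \<in> curve \<inter> axis N m n G'" "dominant_on {v', j'} y"
      show "connected_component_of curve_space z y"
        using connected_component_of_trans[OF zx] linked_points[OF G t G' t' meet x y] by blast
    qed
  qed
  then show ?thesis unfolding Q_def using F' e' by blast
qed

theorem unbounded_component_axis_points:
  defines "unbounded \<equiv> \<lambda>W. W \<in> connected_components_of curve_space \<and> W \<inter> all_axes N m n \<noteq> {}"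
  shows "\<exists>W. unbounded W"
    and "\<And>W F. \<lbrakk>unbounded W; is_side (polygon N m n) F\<rbrakk> \<Longrightarrow>
      finite (W \<inter> axis N m n F) \<and> card (W \<inter> axis N m n F) = integer_length N m n F"
proof -
  obtain F where "F facet_of polygon N m n"
    using polytope_facet_exists[OF polytope_polygon] aff_dim_polygon by auto
  then have F: "is_side (polygon N m n) F" unfolding facet_of_def is_side_def aff_dim_polygon by simp
  obtain z where z: "z \<in> curve" "z \<in> axis N m n F" using axis_points(3)[OF F] by blast
  let ?W = "Collect (connected_component_of curve_space z)"
  have "?W \<in> connected_components_of curve_space"
    unfolding connected_components_of_def topspace_curve_space using z(1) by blast
  moreover have "z \<in> ?W" using z(1) topspace_curve_space by (simp add: connected_component_of_refl)
  moreover have "z \<in> all_axes N m n" unfolding all_axes_def using z(2) F by blast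
  ultimately show "\<exists>W. unbounded W" unfolding unbounded_def by blast
next
  fix W F assume W: "unbounded W" and F: "is_side (polygon N m n) F"
  have comp: "W = Collect (connected_component_of curve_space x)"
    if "x \<in> W" for x
  proof -
    obtain y where "W = Collect (connected_component_of curve_space y)"
      using W unfolding unbounded_def connected_components_of_def by blast
    moreover from this have "connected_component_of curve_space y x" using that by simp
    then have "connected_component_of curve_space y = connected_component_of curve_space x"
      by (rule connected_component_of_equiv[THEN iffD1, THEN conjunct2, THEN conjunct2])
    ultimately show ?thesis by simp
  qed
  obtain x G where x: "x \<in> W" "x \<in> axis N m n G" "is_side (polygon N m n) G"
    using W unfolding unbounded_def all_axes_def by blast
  have sub: "W \<subseteq> curve"
    using W connected_components_of_subset topspace_curve_space unfolding unbounded_def by metis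
  \<comment> \<open>One axis point of \<open>W\<close> suffices: all axis points of the curve are
    connected to it.\<close>
  have "curve \<inter> axis N m n F \<subseteq> W"
  proof
    fix z assume z: "z \<in> curve \<inter> axis N m n F"
    have "connected_component_of curve_space x z"
      using axis_points_connected[OF x(3) _ F z] x sub by blast
    then show "z \<in> W" using comp[OF x(1)] by blast
  qed
  then have "W \<inter> axis N m n F = curve \<inter> axis N m n F" using sub by blast
  then show "finite (W \<inter> axis N m n F) \<and> card (W \<inter> axis N m n F) = integer_length N m n F"
    using axis_points(1,2)[OF F] by simp
qed

end

section \<open>Choice of the bound on the parameters\<close>

theorem theorem5p3p1:
  fixes p :: nat and m n :: "nat \<Rightarrow> int" and T :: "nat set set"
    and s :: "nat set \<Rightarrow> nat \<Rightarrow> nat \<Rightarrow> nat"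
    and H :: "nat \<Rightarrow> (nat \<Rightarrow> int) \<Rightarrow> rat"
  assumes b_distinct: "inj_on (lpt m n) {..<p+3}"
    and b_lattice: "\<forall>z\<in>polygon (p+3) m n. is_lattice_point z \<longleftrightarrow> (\<exists>i<p+3. z = lpt m n i)"
    and b0: "m 0 = 1 \<and> n 0 = 0" and b1: "m 1 = 0 \<and> n 1 = 1" and b2: "m 2 = 0 \<and> n 2 = 0"
    and triang: "unimodular_triangulation (p+3) m n T"
    and sigma1: "{0, 1, 2} \<in> T"
    and H_expansion: "\<forall>\<sigma>\<in>T. \<forall>k<p. \<forall>l\<in>charge_lattice (p+3) m n.
             H k l = of_int (\<Sum>j\<in>{..<p+3} - \<sigma>. int (s \<sigma> k j) * l j)"
    and s_nondeg: "\<forall>\<sigma>\<in>T. \<forall>c :: nat \<Rightarrow> rat.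
             (\<forall>j\<in>{..<p+3} - \<sigma>. (\<Sum>k<p. c k * of_nat (s \<sigma> k j)) = 0) \<longrightarrow> (\<forall>k<p. c k = 0)"
  shows "\<exists>\<epsilon>>0. \<forall>q :: nat \<Rightarrow> real.
           (\<forall>k<p. q k \<noteq> 0 \<and> \<bar>q k\<bar> < \<epsilon>) \<and>
           (\<forall>i<p+3. odd (m i) \<and> odd (n i) \<longrightarrow> mirror_coeff p s i q < 0) \<and>
           (\<forall>i<p+3. (even (m i) \<or> even (n i)) \<longrightarrow> mirror_coeff p s i q > 0)
           \<longrightarrow> (\<exists>W. unbounded_component p m n s q W) \<and>
               (\<forall>W F. unbounded_component p m n s q W \<and> is_side (polygon (p+3) m n) F \<longrightarrow>
                   finite (W \<inter> axis (p+3) m n F) \<and>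
                   card (W \<inter> axis (p+3) m n F) = integer_length (p+3) m n F)"
proof -
  interpret lattice_triangulation "p + 3" m n T
    using b_distinct b_lattice triang by unfold_locales auto
  obtain M where M: "M \<ge> 1"
    "\<And>v i j w. \<lbrakk>tri v i j; w < p + 3\<rbrakk> \<Longrightarrow> \<bar>real_of_int (bcoord m n v i j w)\<bar> \<le> M"
    by (rule bcoord_bound, rule that)
  \<comment> \<open>Chosen so that \<open>c * \<epsilon> \<le> 1\<close> is the smallness condition
    of \<open>harnack_curve\<close> with \<open>\<epsilon>\<close> as \<open>\<eta>\<close>. The cap
    1 on \<open>\<epsilon>\<close> makes \<open>ln \<epsilon>\<close> nonpositive, as
    \<open>mirror_coeff_dominated\<close> requires.\<close>
  define c where "c = 8 * real (p + 3) * M\<^sup>2 * 3 powr (2 * M)"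
  define \<epsilon> where "\<epsilon> = min 1 (1 / c)"
  have c: "c > 0" unfolding c_def using M(1) by simp
  then have \<epsilon>: "\<epsilon> > 0" "\<epsilon> \<le> 1" "c * \<epsilon> \<le> 1" by (simp_all add: \<epsilon>_def min_def field_simps)
  show ?thesis
  proof (intro exI[of _ \<epsilon>] conjI[OF \<epsilon>(1)] allI impI, elim conjE)
    fix q :: "nat \<Rightarrow> real"
    assume q: "\<forall>k<p. q k \<noteq> 0 \<and> \<bar>q k\<bar> < \<epsilon>"
      and neg: "\<forall>i<p+3. odd (m i) \<and> odd (n i) \<longrightarrow> mirror_coeff p s i q < 0"
      and pos: "\<forall>i<p+3. (even (m i) \<or> even (n i)) \<longrightarrow> mirror_coeff p s i q > 0"
    interpret harnack_curve "p + 3" m n T "\<lambda>i. mirror_coeff p s i q" \<epsilon> M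
    proof
      show "8 * real (p + 3) * M\<^sup>2 * (\<epsilon> * 3 powr (2 * M)) \<le> 1"
        using \<epsilon>(3) unfolding c_def by (simp add: mult_ac)
      show "ln \<bar>mirror_coeff p s w q\<bar> - ln \<bar>mirror_coeff p s v q\<bar>
          \<le> ln \<epsilon> + bcoord m n v i j w * (ln \<bar>mirror_coeff p s i q\<bar> - ln \<bar>mirror_coeff p s v q\<bar>)
            + bcoord m n v j i w * (ln \<bar>mirror_coeff p s j q\<bar> - ln \<bar>mirror_coeff p s v q\<bar>)"
        if t: "tri v i j" and w: "w < p + 3" "w \<notin> {v, i, j}" for v i j w
        using t tri_card[OF t] tri_less[OF t]
        by (intro mirror_coeff_dominated[OF sigma1 _ _ _ H_expansion s_nondeg w bcoord_eq[OF t] q \<epsilon>(1,2)])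
          (auto simp: tri_def)
    qed (use neg pos M \<epsilon> in auto)
    have "mirror_curve_closure p m n s q = curve"
      unfolding mirror_curve_closure_def curve_def mirror_poly_def by simp
    then show "(\<exists>W. unbounded_component p m n s q W) \<and>
        (\<forall>W F. unbounded_component p m n s q W \<and> is_side (polygon (p+3) m n) F \<longrightarrow>
          finite (W \<inter> axis (p+3) m n F) \<and> card (W \<inter> axis (p+3) m n F) = integer_length (p+3) m n F)"
      unfolding unbounded_component_def using unbounded_component_axis_points by simp
  qed
qed

end
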